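(* For $i=0,1$ we have $$\mathrm{ch}_{\mathsf q}W_{i,\mathsf q}=\sum_{r\ge0}\frac{t^{r^2+ir}}{(1-t)(1-t^2)\cdots(1-t^r)},$$ where $\mathrm{ch}_{\mathsf q}W_{i,\mathsf q}=\sum_{r\ge0}\dim\left(W_{i,\mathsf q}\right)_r\,t^r$.
   Context: Let $q$ be an indeterminate, $F=\mathbb{C}(q^{1/2})$, $[m]=\frac{q^m-q^{-m}}{q-q^{-1}}$. Let $K(1)=F[a(-1),a(-2),\dots]$ be the polynomial algebra on which $a(-r)$ ($r\ge1$) acts by multiplication and $a(r)$ ($r\ge1$) acts as the derivation with $a(r)\cdot a(-s)=\delta_{rs}\frac{[2r][r]}{r}$. Let $Q=\mathbb{Z}\alpha$, $\lambda=\alpha/2$, $(\alpha,\alpha)=2$; $F\{Q\}$ is the group algebra with basis $e^{\beta}$, $\beta\in Q$; $L_0=K(1)\otimes F\{Q\}$, $L_1=K(1)\otimes F\{Q\}e^{\lambda}$; $z^{\partial_\mu}e^\beta=z^{(\mu,\beta)}e^\beta$ (similarly $(-z)^{\partial_\mu}$). The Frenkel–Jing operator on $L_0$ and on $L_1$ is $$x(z)=\exp\Big(\sum_{r\ge1}\tfrac{q^{-r/2}}{[r]}a(-r)z^r\Big)\exp\Big(-\sum_{r\ge1}\tfrac{q^{-r/2}}{[r]}a(r)z^{-r}\Big)\otimes e^{\alpha}z^{\partial_\alpha},$$ and Koyama's operator is $$\mathcal{Y}(z)=\exp\Big(\sum_{r\ge1}\tfrac{q^{r/2}}{[2r]}a(-r)z^r\Big)\exp\Big(-\sum_{r\ge1}\tfrac{q^{r/2}}{[2r]}a(r)z^{-r}\Big)\otimes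 e^{\lambda}(-z)^{\partial_\lambda}\in\mathrm{Hom}(L_0,L_1((z))).$$ Set $\mathsf q=q^2$, $[m]_{\mathsf q}=\frac{\mathsf q^m-1}{\mathsf q-1}$, $[l]_{\mathsf q}!=[l]_{\mathsf q}\cdots[1]_{\mathsf q}$; $a^{[1]}(z)=\frac{a(z\mathsf q)-a(z)}{z(\mathsf q-1)}$ and $a^{[n]}$ is the $n$-th iterate. For $l\le-1$ put $x(z)_l\,b(z)=\frac{1}{[-l-1]_{\mathsf q}!}x^{[-l-1]}(z)\,b(z\mathsf q^{-l-1})$; iterated expressions are nested to the right. Let $a_0(z)=1$ (identity of $L_0$), $a_1(z)=\mathcal{Y}(z)$. $W_{i,\mathsf q}$ is the $F$-span of all $x(z)_{l_m}\cdots x(z)_{l_1}a_i(z)$ with $m\ge0$, $l_j\le-1$. It has the basis $$\mathfrak{B}_{W_{i,\mathsf q}}=\{x(z)_{l_m}\cdots x(z)_{l_1}a_i(z)\;:\;m\ge0,\ l_1\le-1-i,\ l_r\le-3\text{ for }r=2,\dots,m\}.$$ For a basis element $b(z)=x(z)_{l_m}\cdots x(z)_{l_1}a_i(z)$ set $D_k=\sum_{p=1}^kl_p+k-1$ for $k=1,\dots,m$ and $\deg_{\mathsf q}b(z)=-\sum_{k=1}^mD_k$. Let $(W_{i,\mathsf q})_r$ be the span of the basis elements in $\mathfrak{B}_{W_{i,\mathsf q}}$ of degree $\deg_{\mathsf q}=r$; these are finite-dimensional and $W_{i,\mathsf q}=\bigoplus_{r\ge0}(W_{i,\mathsf q})_r$.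 The variable $t$ is a formal variable. *)

theory Defs
  imports
    "HOL-Computational_Algebra.Computational_Algebra"
    "HOL-Library.Poly_Mapping"
    "HOL-Library.Groups_Big_Fun"
    "HOL-Library.Function_Algebras"
begin

type_synonym F = "complex poly fract"

definition sqrt_q :: F where
  "sqrt_q = Fract [:0, 1:] 1"

definition q_ind :: F where
  "q_ind = sqrt_q ^ 2"

definition qint :: "nat \<Rightarrow> F" where
  "qint m = (q_ind ^ m - inverse q_ind ^ m) / (q_ind - inverse q_ind)"

definition qq :: F where
  "qq = q_ind ^ 2"

definition qqint :: "nat \<Rightarrow> F" where
  "qqint m = (qq ^ m - 1) / (qq - 1)"

definition qqfact :: "nat \<Rightarrow> F" where
  "qqfact l = (\<Prod>k = 1..l. qqint k)"

text \<open>
  \<open>K1\<close> is the polynomial algebra in \<open>a(-1), a(-2), \<dots>\<close>; the variable with index \<open>k\<close>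
  is \<open>a(-(k+1))\<close>, so that every natural number is the index of a variable.

  \<open>L\<close> represents both \<open>L\<^sub>0\<close> and \<open>L\<^sub>1\<close>, as the free \<open>K1\<close>-module on a basis indexed by \<open>\<int>\<close>:
  in \<open>L\<^sub>i\<close> the index \<open>n\<close> stands for \<open>e\<close> to the power \<open>n\<alpha> + i\<lambda>\<close>.
\<close>

type_synonym K1 = "(nat \<Rightarrow>\<^sub>0 nat) \<Rightarrow>\<^sub>0 F"

type_synonym L = "int \<Rightarrow>\<^sub>0 K1"

definition scalar :: "F \<Rightarrow> L" where
  "scalar c = Poly_Mapping.single 0 (Poly_Mapping.single 0 c)"

definition heis_var :: "nat \<Rightarrow> K1" where
  "heis_var r = Poly_Mapping.single (Poly_Mapping.single (r - 1) 1) 1"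

definition heis_deriv :: "nat \<Rightarrow> K1 \<Rightarrow> K1" where
  "heis_deriv r f =
     (\<Sum>m \<in> Poly_Mapping.keys f.
        Poly_Mapping.single (m - Poly_Mapping.single (r - 1) 1)
          (qint (2 * r) * qint r / of_nat r * of_nat (Poly_Mapping.lookup m (r - 1))
            * Poly_Mapping.lookup f m))"

definition a_neg :: "nat \<Rightarrow> L \<Rightarrow> L" where
  "a_neg r v = Poly_Mapping.single 0 (heis_var r) * v"

definition a_pos :: "nat \<Rightarrow> L \<Rightarrow> L" where
  "a_pos r v = Poly_Mapping.map (heis_deriv r) v"

text \<open>
  An element \<open>b(z)\<close> of \<open>Hom(L\<^sub>i, L\<^sub>j((z)))\<close> is represented by the map \<open>v \<mapsto> b(z)v\<close>.
\<close>

type_synonym op_series = "L \<Rightarrow> L fls"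

definition op_scale :: "F \<Rightarrow> op_series \<Rightarrow> op_series" where
  "op_scale c b = (\<lambda>v. fls_const (scalar c) * b v)"

text \<open>
  The product \<open>a(z)b(z)\<close>: its coefficient of \<open>z\<close> to the power \<open>k\<close> is the sum over \<open>s + j = k\<close>
  of the coefficients of \<open>a(z\<^sub>1)b(z\<^sub>2)\<close>. This is the substitution \<open>z\<^sub>1 = z\<^sub>2 = z\<close>, meaningful
  whenever \<open>a(z\<^sub>1)b(z\<^sub>2)v\<close> is a Laurent series in the two variables \<open>z\<^sub>1, z\<^sub>2\<close>; the sums are then
  finite.
\<close>

definition op_mult :: "op_series \<Rightarrow> op_series \<Rightarrow> op_series" where
  "op_mult a b =
     (\<lambda>v. Abs_fls (\<lambda>k. Sum_any (\<lambda>j. fls_nth (a (fls_nth (b v) j)) (k - j))))"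

definition op_dilate :: "F \<Rightarrow> op_series \<Rightarrow> op_series" where
  "op_dilate c b = (\<lambda>v. Abs_fls (\<lambda>j. scalar (c powi j) * fls_nth (b v) j))"

text \<open>
  For operators \<open>B 1, B 2, \<dots>\<close>, \<open>op_pow B k n\<close> and \<open>op_exp B n\<close> are the coefficients of
  \<open>w\<close> to the power \<open>n\<close> in the \<open>k\<close>-th power and in the exponential of the sum of the
  \<open>B r\<close> times \<open>w\<close> to the power \<open>r\<close>, over \<open>r \<ge> 1\<close>.
\<close>

primrec op_pow :: "(nat \<Rightarrow> L \<Rightarrow> L) \<Rightarrow> nat \<Rightarrow> nat \<Rightarrow> L \<Rightarrow> L" where
  "op_pow B 0 n v = (if n = 0 then v else 0)"
| "op_pow B (Suc k) n v = (\<Sum>r = 1..n. B r (op_pow B k (n - r) v))"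

definition op_exp :: "(nat \<Rightarrow> L \<Rightarrow> L) \<Rightarrow> nat \<Rightarrow> L \<Rightarrow> L" where
  "op_exp B n v = (\<Sum>k\<le>n. scalar (1 / of_nat (fact k)) * op_pow B k n v)"

text \<open>
  The exponentials of the sums over \<open>r \<ge> 1\<close> of \<open>c r a(-r)\<close> times \<open>z\<close> to the power \<open>r\<close>, and of
  \<open>- c r a(r)\<close> times \<open>z\<close> to the power \<open>-r\<close>.
\<close>

definition exp_neg :: "(nat \<Rightarrow> F) \<Rightarrow> op_series" where
  "exp_neg c =
     (\<lambda>v. Abs_fls (\<lambda>k. if k \<ge> 0 then op_exp (\<lambda>r u. scalar (c r) * a_neg r u) (nat k) v else 0))"

definition exp_pos :: "(nat \<Rightarrow> F) \<Rightarrow> op_series" where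
  "exp_pos c =
     (\<lambda>v. Abs_fls (\<lambda>k. if k \<le> 0 then op_exp (\<lambda>r u. scalar (- c r) * a_pos r u) (nat (- k)) v else 0))"

text \<open>
  The lattice part of \<open>x(z)\<close> on \<open>L\<^sub>i\<close> uses \<open>(\<alpha>, n\<alpha> + i\<lambda>) = 2n + i\<close>, that of \<open>\<Y>(z)\<close> uses
  \<open>(\<lambda>, n\<alpha>) = n\<close>. Multiplication by \<open>e\<close> to the power \<open>\<lambda>\<close> maps the basis element with index \<open>n\<close>
  of \<open>L\<^sub>0\<close> to the one with index \<open>n\<close> of \<open>L\<^sub>1\<close>.
\<close>

definition lattice_x :: "nat \<Rightarrow> op_series" where
  "lattice_x i =
     (\<lambda>v. \<Sum>n \<in> Poly_Mapping.keys v.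
        fls_shift (- (2 * n + int i))
          (fls_const (Poly_Mapping.single (n + 1) (Poly_Mapping.lookup v n))))"

definition lattice_Y :: op_series where
  "lattice_Y =
     (\<lambda>v. \<Sum>n \<in> Poly_Mapping.keys v.
        fls_shift (- n)
          (fls_const (scalar ((-1) powi n) * Poly_Mapping.single n (Poly_Mapping.lookup v n))))"

definition frenkel_jing :: "nat \<Rightarrow> op_series" where
  "frenkel_jing i =
     (let c = (\<lambda>r. inverse sqrt_q ^ r / qint r)
      in op_mult (exp_neg c) (op_mult (exp_pos c) (lattice_x i)))"

definition koyama :: op_series where
  "koyama =
     (let c = (\<lambda>r. sqrt_q ^ r / qint (2 * r))
      in op_mult (exp_neg c) (op_mult (exp_pos c) lattice_Y))"

definition q_deriv :: "op_series \<Rightarrow> op_series" where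
  "q_deriv a =
     (\<lambda>v. fls_const (scalar (1 / (qq - 1))) * fls_shift 1 (op_dilate qq a v - a v))"

definition x_prod :: "nat \<Rightarrow> int \<Rightarrow> op_series \<Rightarrow> op_series" where
  "x_prod i l b =
     (let n = nat (- l - 1)
      in op_scale (1 / qqfact n)
           (op_mult ((q_deriv ^^ n) (frenkel_jing i)) (op_dilate (qq ^ n) b)))"

definition a_op :: "nat \<Rightarrow> op_series" where
  "a_op i = (if i = 0 then fls_const else koyama)"

text \<open>The list argument is \<open>[l\<^sub>1, \<dots>, l\<^sub>m]\<close>; its last entry gives the outermost product.\<close>

definition x_monomial :: "nat \<Rightarrow> int list \<Rightarrow> op_series" where
  "x_monomial i ls = fold (x_prod i) ls (a_op i)"

definition Wq :: "nat \<Rightarrow> op_series set" where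
  "Wq i = module.span op_scale {x_monomial i ls | ls. \<forall>l \<in> set ls. l \<le> -1}"

definition basis_index :: "nat \<Rightarrow> int list \<Rightarrow> bool" where
  "basis_index i ls \<longleftrightarrow>
     (\<forall>j < length ls. ls ! j \<le> (if j = 0 then - 1 - int i else - 3))"

definition deg_D :: "int list \<Rightarrow> nat \<Rightarrow> int" where
  "deg_D ls k = (\<Sum>p = 1..k. ls ! (p - 1)) + int k - 1"

definition deg_q :: "int list \<Rightarrow> int" where
  "deg_q ls = - (\<Sum>k = 1..length ls. deg_D ls k)"

definition Wq_graded :: "nat \<Rightarrow> nat \<Rightarrow> op_series set" where
  "Wq_graded i r =
     module.span op_scale {x_monomial i ls | ls. basis_index i ls \<and> deg_q ls = int r}"

definition ch_Wq :: "nat \<Rightarrow> rat fps" where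
  "ch_Wq i = Abs_fps (\<lambda>r. of_nat (vector_space.dim op_scale (Wq_graded i r)))"


lemma scalar_0 [simp]: "scalar 0 = 0"
  and scalar_1 [simp]: "scalar 1 = 1"
  and scalar_add: "scalar (c + d) = scalar c + scalar d"
  and scalar_mult: "scalar (c * d) = scalar c * scalar d"
  by (simp_all add: scalar_def single_add mult_single)

lemma fls_const_add': "fls_const (u + v :: L) = fls_const u + fls_const v"
  by (rule fls_eqI) simp

global_interpretation op_space: vector_space op_scale
proof
  fix c d :: F and a b :: op_series
  show "op_scale c (a + b) = op_scale c a + op_scale c b"
    by (simp add: op_scale_def fun_eq_iff distrib_left)
  show "op_scale (c + d) a = op_scale c a + op_scale d a"
    by (simp add: op_scale_def fun_eq_iff scalar_add fls_const_add' distrib_right)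
  show "op_scale c (op_scale d a) = op_scale (c * d) a"
    by (simp add: op_scale_def fun_eq_iff scalar_mult fls_const_mult_const mult.assoc [symmetric])
  show "op_scale 1 a = a"
    by (simp add: op_scale_def fun_eq_iff)
qed

lemma Wq_graded_subset_Wq: "Wq_graded i r \<subseteq> Wq i"
proof -
  have "\<forall>l \<in> set ls. l \<le> -1" if "basis_index i ls" for ls
    using that by (force simp: basis_index_def in_set_conv_nth split: if_splits)
  thus ?thesis
    unfolding Wq_graded_def Wq_def by (intro op_space.span_mono) blast
qed

lemma heis_deriv_var:
  assumes "r \<ge> 1" "s \<ge> 1"
  shows "heis_deriv r (heis_var s) =
    Poly_Mapping.single 0 (if r = s then qint (2 * r) * qint r / of_nat r else 0)"
  using assms by (auto simp: heis_deriv_def heis_var_def lookup_single)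

lemma heis_deriv_add: "heis_deriv r (f + g) = heis_deriv r f + heis_deriv r g"
proof -
  let ?t = "\<lambda>h m. Poly_Mapping.single (m - Poly_Mapping.single (r - 1) 1)
          (qint (2 * r) * qint r / of_nat r * of_nat (Poly_Mapping.lookup m (r - 1)) * h m)"
  have *: "heis_deriv r h = (\<Sum>m \<in> Poly_Mapping.keys f \<union> Poly_Mapping.keys g. ?t (Poly_Mapping.lookup h) m)"
    if "Poly_Mapping.keys h \<subseteq> Poly_Mapping.keys f \<union> Poly_Mapping.keys g" for h
    unfolding heis_deriv_def using that
    by (intro sum.mono_neutral_left) (auto simp: in_keys_iff)
  show ?thesis
    by (subst (1 2 3) *)
       (auto simp: lookup_add distrib_left single_add sum.distrib dest: subsetD [OF Poly_Mapping.keys_add])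
qed

lemma heis_deriv_single:
  "heis_deriv r (Poly_Mapping.single m c) =
     Poly_Mapping.single (m - Poly_Mapping.single (r - 1) 1)
       (qint (2 * r) * qint r / of_nat r * of_nat (Poly_Mapping.lookup m (r - 1)) * c)"
  by (cases "c = 0") (simp_all add: heis_deriv_def)

lemma poly_mapping_single_add_induct [case_names single add]:
  fixes f :: "'a \<Rightarrow>\<^sub>0 'b::comm_monoid_add"
  assumes single: "\<And>m c. P (Poly_Mapping.single m c)"
    and add: "\<And>f g. P f \<Longrightarrow> P g \<Longrightarrow> P (f + g)"
  shows "P f"
proof (induction f rule: update_induct)
  case const
  show ?case using single [of undefined 0] by simp
next
  case (update f a b)
  have "Poly_Mapping.update a b f = f + Poly_Mapping.single a b"
    using update(1)
    by (intro poly_mapping_eqI) (auto simp: lookup_update lookup_add lookup_single in_keys_iff when_def)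
  thus ?case using add [OF update(3) single] by simp
qed

lemma heis_deriv_mult: "heis_deriv r (f * g) = heis_deriv r f * g + f * heis_deriv r g"
proof (induction f rule: poly_mapping_single_add_induct)
  case (single m c)
  show ?case
  proof (induction g rule: poly_mapping_single_add_induct)
    case (single n d)
    define e :: "nat \<Rightarrow>\<^sub>0 nat" where "e = Poly_Mapping.single (r - 1) 1"
    define C where "C = qint (2 * r) * qint r / of_nat r"
    let ?d = "\<lambda>m. of_nat (Poly_Mapping.lookup m (r - 1)) :: F"
    have *: "m - e + n = m + n - e" if "Poly_Mapping.lookup m (r - 1) \<noteq> 0" for m n
      using that unfolding e_def
      by (intro poly_mapping_eqI) (auto simp: lookup_add lookup_minus lookup_single when_def)
    have D: "heis_deriv r (Poly_Mapping.single m c) = Poly_Mapping.single (m - e) (C * ?d m * c)" for m c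
      unfolding heis_deriv_single e_def C_def ..
    have 1: "Poly_Mapping.single (m - e + n) (C * ?d m * c * d) =
        Poly_Mapping.single (m + n - e) (C * ?d m * c * d)"
      by (cases "Poly_Mapping.lookup m (r - 1) = 0") (simp_all add: *)
    have 2: "Poly_Mapping.single (m + (n - e)) (c * (C * ?d n * d)) =
        Poly_Mapping.single (m + n - e) (c * (C * ?d n * d))"
      using * [of n m] by (cases "Poly_Mapping.lookup n (r - 1) = 0") (simp_all add: add.commute)
    have 3: "C * ?d (m + n) * (c * d) = C * ?d m * c * d + c * (C * ?d n * d)"
      by (simp add: lookup_add algebra_simps)
    show ?case
      by (simp only: D mult_single 1 2 3 single_add)
  qed (simp add: heis_deriv_add algebra_simps)
qed (simp add: heis_deriv_add algebra_simps)

end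

theory Submission
  imports Defs
begin

text \<open>
  Applied to the vacuum, a monomial in \<open>x(z)\<close> with modes \<open>l\<^sub>m, \<dots>, l\<^sub>1\<close> becomes a finite sum of
  exponentials \<open>exp (\<Sum>r. \<gamma> r a(-r) z\<^sup>r)\<close>: a product of Frenkel--Jing operators contracts to the
  polynomial factors \<open>(1 - qq\<^sup>e w)(1 - qq\<^sup>e\<^sup>-\<^sup>1 w)\<close>, and the \<open>n\<close>-th \<open>qq\<close>-derivative is \<open>z\<^sup>-\<^sup>n\<close> times
  a combination of the dilations \<open>z \<mapsto> z qq\<^sup>h\<close>, \<open>h \<le> n\<close>. So each exponential is labelled by a list
  of exponents \<open>e\<close>, with \<open>\<gamma> 1\<close> an affine function of the sum of the \<open>qq\<close>-powers of \<open>e\<close>.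
  The coefficients of the powers of \<open>a(-1)\<close> are the power sums of the \<open>\<gamma> 1\<close>, and a Vandermonde
  argument separates the multisets \<open>e\<close>. Under the conditions on the basis indices the
  term with \<open>h = 0\<close> throughout has a nonzero coefficient; it is the unique term with the least sum of
  exponents and it determines the monomial, so the monomials are linearly independent.
  Subtracting the largest admissible modes from the \<open>l\<^sub>j\<close> turns the degree into
  \<open>m\<^sup>2 + i m\<close> plus the size of a partition into parts at most \<open>m\<close>.
\<close>

unbundle fps_syntax

section \<open>The base field and the constants of the polynomial algebra\<close>

lemma sqrt_q_power: "sqrt_q ^ n = Fract (monom 1 n) 1"
proof (induction n)
  case 0
  show ?case by (simp add: One_fract_def monom_0 one_pCons)
next
  case (Suc n)
  have "[:0, 1:] * monom 1 n = (monom 1 (Suc n) :: complex poly)"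
    by (simp add: monom_Suc)
  thus ?case using Suc by (simp add: sqrt_q_def)
qed

lemma sqrt_q_nonzero [simp]: "sqrt_q \<noteq> 0"
  by (simp add: sqrt_q_def Zero_fract_def eq_fract)

lemma of_nat_F: "(of_nat k :: F) = Fract (of_nat k) 1"
  by (induction k) (simp_all add: Zero_fract_def One_fract_def)

lemma of_nat_F_nonzero [simp]: "n > 0 \<Longrightarrow> (of_nat n :: F) \<noteq> 0"
  by (simp add: of_nat_F Zero_fract_def eq_fract)

text \<open>Powers of \<open>sqrt_q\<close> are images of monomials, hence linearly independent over
  the complex numbers, where \<open>of_nat\<close> is injective. This later recovers multiplicities
  from a sum of powers.\<close>

lemma sum_sqrt_q_power_eqD:
  assumes "finite A"
    and "(\<Sum>n\<in>A. of_nat (a n) * sqrt_q ^ n) = (\<Sum>n\<in>A. of_nat (b n) * sqrt_q ^ n)" and "n \<in> A"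
  shows "a n = b n"
proof -
  have *: "(\<Sum>n\<in>A. of_nat (a n) * sqrt_q ^ n) = Fract (\<Sum>n\<in>A. monom (of_nat (a n)) n) 1" for a
    using \<open>finite A\<close>
  proof (induction A rule: finite_induct)
    case empty
    show ?case by (simp add: Zero_fract_def)
  next
    case (insert x A)
    have "of_nat (a x) * monom 1 x = (monom (of_nat (a x)) x :: complex poly)"
      by (simp add: of_nat_poly smult_monom)
    with insert show ?case by (simp add: sqrt_q_power of_nat_F)
  qed
  from assms(2) have "(\<Sum>n\<in>A. monom (of_nat (a n)) n) = (\<Sum>n\<in>A. monom (of_nat (b n)) n :: complex poly)"
    unfolding * by (simp add: eq_fract)
  hence "coeff (\<Sum>n\<in>A. monom (of_nat (a n)) n) n = coeff (\<Sum>n\<in>A. monom (of_nat (b n)) n :: complex poly) n"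
    by simp
  thus ?thesis using assms(1,3) by (simp add: coeff_sum if_distrib cong: if_cong)
qed

lemma qq_eq_sqrt_q: "qq = sqrt_q ^ 4"
  by (simp add: qq_def q_ind_def flip: power_mult)

lemma sqrt_q_power_inj: "sqrt_q ^ m = sqrt_q ^ n \<longleftrightarrow> m = n"
proof
  assume "sqrt_q ^ m = sqrt_q ^ n"
  hence "monom 1 m = (monom 1 n :: complex poly)"
    by (simp add: sqrt_q_power eq_fract)
  thus "m = n" by (metis degree_monom_eq one_neq_zero)
qed simp

lemma qq_nonzero [simp]: "qq \<noteq> 0" and q_ind_nonzero [simp]: "q_ind \<noteq> 0"
  by (simp_all add: qq_def q_ind_def)

lemma qq_power_inj: "qq ^ m = qq ^ n \<longleftrightarrow> m = n"
  by (simp add: qq_eq_sqrt_q sqrt_q_power_inj flip: power_mult)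

lemma qq_power_eq_1_iff [simp]: "qq ^ m = 1 \<longleftrightarrow> m = 0"
  using qq_power_inj[of m 0] by simp

lemma qq_minus_1_nonzero [simp]: "qq - 1 \<noteq> 0"
  using qq_power_eq_1_iff[of 1] by simp

lemma qq_neq_1 [simp]: "qq \<noteq> 1"
  using qq_minus_1_nonzero by simp

lemma qqfact_nonzero [simp]: "qqfact n \<noteq> 0"
  by (auto simp: qqfact_def qqint_def)

lemma q_ind_power_neq_inverse: "m > 0 \<Longrightarrow> q_ind ^ m - inverse q_ind ^ m \<noteq> 0"
proof
  assume "m > 0" and "q_ind ^ m - inverse q_ind ^ m = 0"
  hence "q_ind ^ m * q_ind ^ m = q_ind ^ m * inverse q_ind ^ m" by simp
  also have "\<dots> = 1" by (simp flip: power_mult_distrib)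
  finally have "q_ind ^ m * q_ind ^ m = 1" .
  hence "qq ^ m = 1" by (simp add: qq_def flip: power_add power_mult mult_2)
  thus False using \<open>m > 0\<close> by simp
qed

lemma qint_nonzero [simp]: "m > 0 \<Longrightarrow> qint m \<noteq> 0"
  using q_ind_power_neq_inverse[of m] q_ind_power_neq_inverse[of 1]
  by (simp add: qint_def)

text \<open>A difference of two squares. The factor \<open>q^r + q^-r\<close> is the source of the
  two linear factors in the contraction of two Frenkel--Jing operators.\<close>

lemma qint_double: "qint (2 * r) = (q_ind ^ r + inverse q_ind ^ r) * qint r"
proof -
  have "q_ind ^ (2 * r) - inverse q_ind ^ (2 * r)
      = (q_ind ^ r + inverse q_ind ^ r) * (q_ind ^ r - inverse q_ind ^ r)"
    unfolding mult_2 power_add by (simp only: algebra_simps)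
  thus ?thesis by (simp only: qint_def times_divide_eq_right)
qed

section \<open>Structure constants of the contractions\<close>

definition fj_coeff :: "nat \<Rightarrow> F" where
  "fj_coeff r = inverse sqrt_q ^ r / qint r"

definition koyama_coeff :: "nat \<Rightarrow> F" where
  "koyama_coeff r = sqrt_q ^ r / qint (2 * r)"

text \<open>The scalar \<open>[a(r), a(-r)]\<close>.\<close>

definition heis_level :: "nat \<Rightarrow> F" where
  "heis_level r = qint (2 * r) * qint r / of_nat r"

lemma fj_coeff_nonzero: "r > 0 \<Longrightarrow> fj_coeff r \<noteq> 0"
  by (simp add: fj_coeff_def)

text \<open>The product is \<open>q^-r [2r] / (r [r])\<close>, that is, minus the coefficient of
  \<open>w^r\<close> in \<open>log ((1 - w) (1 - w / qq))\<close>.\<close>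

lemma fj_fj_level:
  assumes "r > 0"
  shows "fj_coeff r * heis_level r * fj_coeff r = (1 + inverse qq ^ r) / of_nat r"
proof -
  have "qint r \<noteq> 0" using assms by simp
  hence "fj_coeff r * heis_level r * fj_coeff r
      = (q_ind ^ r + inverse q_ind ^ r) * (inverse sqrt_q ^ r * inverse sqrt_q ^ r) / of_nat r"
    by (simp add: fj_coeff_def heis_level_def qint_double)
  also have "inverse sqrt_q ^ r * inverse sqrt_q ^ r = inverse q_ind ^ r"
    by (simp add: q_ind_def power2_eq_square flip: power_mult_distrib)
  also have "(q_ind ^ r + inverse q_ind ^ r) * inverse q_ind ^ r = 1 + inverse qq ^ r"
  proof -
    have "q_ind ^ r * inverse q_ind ^ r = 1" "inverse q_ind ^ r * inverse q_ind ^ r = inverse qq ^ r"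
      by (simp_all add: qq_def power2_eq_square flip: power_mult_distrib)
    thus ?thesis by (simp only: distrib_right)
  qed
  finally show ?thesis .
qed

text \<open>The half powers of \<open>q\<close> and both quantum integers cancel, leaving minus the
  coefficient of \<open>w^r\<close> in \<open>log (1 - w)\<close>: a single linear factor.\<close>

lemma fj_koyama_level:
  assumes "r > 0"
  shows "fj_coeff r * heis_level r * koyama_coeff r = 1 / of_nat r"
proof -
  have "inverse sqrt_q ^ r * sqrt_q ^ r = 1"
    by (simp flip: power_mult_distrib)
  moreover have "fj_coeff r * heis_level r * koyama_coeff r =
      (inverse sqrt_q ^ r * sqrt_q ^ r) * (qint r / qint r) * (qint (2 * r) / qint (2 * r)) / of_nat r"
    by (simp only: fj_coeff_def heis_level_def koyama_coeff_def times_divide_eq_right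
        times_divide_eq_left divide_divide_eq_left mult_ac)
  ultimately show ?thesis using assms by simp
qed

section \<open>Scalars inside the polynomial algebra\<close>

definition K1_const :: "F \<Rightarrow> K1" where
  "K1_const c = Poly_Mapping.single 0 c"

lemma K1_const_0 [simp]: "K1_const 0 = 0"
  and K1_const_1 [simp]: "K1_const 1 = 1"
  and K1_const_add: "K1_const (c + d) = K1_const c + K1_const d"
  and K1_const_mult: "K1_const (c * d) = K1_const c * K1_const d"
  by (simp_all add: K1_const_def single_add mult_single)

lemma K1_const_uminus: "K1_const (- c) = - K1_const c"
  by (simp add: K1_const_def single_uminus)

lemma K1_const_diff: "K1_const (c - d) = K1_const c - K1_const d"
  by (simp add: K1_const_def single_diff)

lemma K1_const_of_nat: "K1_const (of_nat n) = of_nat n"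
  by (induction n) (simp_all add: K1_const_add)

lemma K1_const_power: "K1_const (c ^ n) = K1_const c ^ n"
  by (induction n) (simp_all add: K1_const_mult)

lemma K1_const_sum: "K1_const (\<Sum>x\<in>A. f x) = (\<Sum>x\<in>A. K1_const (f x))"
  by (induction A rule: infinite_finite_induct) (simp_all add: K1_const_add)

lemma lookup_K1_const_mult: "Poly_Mapping.lookup (K1_const c * f) m = c * Poly_Mapping.lookup f m"
proof (induction f rule: poly_mapping_single_add_induct)
  case (single n d)
  show ?case by (simp add: K1_const_def mult_single lookup_single when_def)
qed (simp add: lookup_add distrib_left)

lemma K1_const_cancel: "c \<noteq> 0 \<Longrightarrow> K1_const c * f = K1_const c * g \<Longrightarrow> f = g"
proof -
  assume "c \<noteq> 0" and "K1_const c * f = K1_const c * g"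
  hence "K1_const (inverse c) * (K1_const c * f) = K1_const (inverse c) * (K1_const c * g)"
    by simp
  thus "f = g" using \<open>c \<noteq> 0\<close> by (simp flip: mult.assoc K1_const_mult)
qed

lemma of_nat_K1_cancel:
  fixes f g :: K1
  assumes "n > 0" and "of_nat n * f = of_nat n * g"
  shows "f = g"
  using of_nat_F_nonzero[OF assms(1)] K1_const_cancel[of "of_nat n" f g] assms unfolding K1_const_of_nat by blast

lemma heis_deriv_0 [simp]: "heis_deriv r 0 = 0"
  by (simp add: heis_deriv_def)

lemma heis_deriv_const [simp]: "heis_deriv r (K1_const c) = 0"
  by (simp add: K1_const_def heis_deriv_single)

lemma heis_deriv_const_mult: "heis_deriv r (K1_const c * f) = K1_const c * heis_deriv r f"
  by (simp add: heis_deriv_mult)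

lemma heis_deriv_sum: "heis_deriv r (\<Sum>x\<in>A. f x) = (\<Sum>x\<in>A. heis_deriv r (f x))"
  by (induction A rule: infinite_finite_induct) (simp_all add: heis_deriv_add)

lemma heis_deriv_var':
  assumes "r \<ge> 1" "s \<ge> 1"
  shows "heis_deriv r (heis_var s) = (if r = s then K1_const (heis_level r) else 0)"
  using heis_deriv_var[OF assms] by (simp add: K1_const_def heis_level_def)

section \<open>Exponentials of creation operators\<close>

text \<open>Stopping at \<open>k = n\<close> loses nothing when \<open>A\<close> has no constant
  term, since \<open>A ^ k\<close> then starts in degree \<open>k\<close>. The finite form matches
  \<open>op_exp\<close>.\<close>

definition K1_exp :: "K1 fps \<Rightarrow> K1 fps" where
  "K1_exp A = Abs_fps (\<lambda>n. \<Sum>k\<le>n. K1_const (1 / of_nat (fact k)) * (A ^ k) $ n)"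

lemma fps_power_nth_eq_0:
  fixes A :: "'a::comm_ring_1 fps"
  assumes "A $ 0 = 0" and "n < k"
  shows "(A ^ k) $ n = 0"
  using startsby_zero_power_prefix[OF assms(1), of k] assms(2) by auto

lemma inverse_fact_Suc: "1 / of_nat (fact (Suc k)) * of_nat (Suc k) = (1 / of_nat (fact k) :: F)"
proof -
  have "(of_nat (Suc k) :: F) \<noteq> 0" by (rule of_nat_F_nonzero) simp
  moreover have "(of_nat (fact (Suc k)) :: F) = of_nat (Suc k) * of_nat (fact k)"
    by (simp only: fact_Suc of_nat_mult of_nat_id)
  ultimately show ?thesis by (simp del: of_nat_Suc fact_Suc)
qed

lemma K1_exp_nth:
  assumes "A $ 0 = 0" "n \<le> N"
  shows "K1_exp A $ n = (\<Sum>k\<le>N. K1_const (1 / of_nat (fact k)) * (A ^ k) $ n)"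
  unfolding K1_exp_def fps_nth_Abs_fps
  using assms by (intro sum.mono_neutral_left) (auto simp: fps_power_nth_eq_0)

lemma K1_exp_nth_0 [simp]: "K1_exp A $ 0 = 1"
  by (simp add: K1_exp_def)

lemma fps_deriv_K1_exp:
  assumes "A $ 0 = 0"
  shows "fps_deriv (K1_exp A) = fps_deriv A * K1_exp A"
proof (rule fps_ext)
  fix n
  let ?c = "\<lambda>k. K1_const (1 / of_nat (fact k))"
  have c: "?c (Suc k) * of_nat (Suc k) = ?c k" for k
    by (simp only: K1_const_mult[symmetric] K1_const_of_nat[symmetric] inverse_fact_Suc)
  have "fps_deriv (K1_exp A) $ n = of_nat (n + 1) * (\<Sum>k\<le>Suc n. ?c k * (A ^ k) $ Suc n)"
    by (simp add: K1_exp_nth[OF assms, of "Suc n" "Suc n"] del: sum.atMost_Suc)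
  also have "\<dots> = (\<Sum>k\<le>Suc n. ?c k * fps_deriv (A ^ k) $ n)"
    by (simp add: sum_distrib_left mult_ac del: sum.atMost_Suc)
  \<comment> \<open>The summand for \<open>k = 0\<close> is the derivative of a constant; after the
    shift, \<open>k + 1\<close> from the power rule cancels against \<open>(k + 1)!\<close>.\<close>
  also have "\<dots> = (\<Sum>k\<le>n. ?c (Suc k) * fps_deriv (A ^ Suc k) $ n)"
    by (subst sum.atMost_Suc_shift) simp
  also have "\<dots> = (\<Sum>k\<le>n. ?c k * (fps_deriv A * A ^ k) $ n)"
  proof (intro sum.cong refl)
    fix k
    have "fps_deriv (A ^ Suc k) $ n = of_nat (Suc k) * (fps_deriv A * A ^ k) $ n"
      by (simp add: fps_deriv_power fps_of_nat[symmetric] mult.assoc del: power_Suc of_nat_Suc)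
    thus "?c (Suc k) * fps_deriv (A ^ Suc k) $ n = ?c k * (fps_deriv A * A ^ k) $ n"
      by (simp only: mult.assoc[symmetric] c)
  qed
  also have "\<dots> = (\<Sum>j=0..n. fps_deriv A $ j * (\<Sum>k\<le>n. ?c k * (A ^ k) $ (n - j)))"
    unfolding fps_mult_nth sum_distrib_left by (subst sum.swap) (simp add: mult_ac)
  also have "\<dots> = (\<Sum>j=0..n. fps_deriv A $ j * K1_exp A $ (n - j))"
    by (intro sum.cong refl) (simp add: K1_exp_nth[OF assms, of _ n])
  finally show "fps_deriv (K1_exp A) $ n = (fps_deriv A * K1_exp A) $ n"
    by (simp add: fps_mult_nth)
qed

text \<open>Coefficient \<open>k\<close> of the equation expresses \<open>k + 1\<close> times
  coefficient \<open>k + 1\<close> through lower ones, and positive integers can be cancelled in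
  \<open>K1\<close>. Exponentials are identified this way instead of by rearranging double
  series.\<close>

lemma K1_fps_ode_unique:
  fixes f g a :: "K1 fps"
  assumes "fps_deriv f = a * f" "fps_deriv g = a * g" "f $ 0 = g $ 0"
  shows "f = g"
proof (rule fps_ext)
  fix n
  show "f $ n = g $ n"
  proof (induction n rule: less_induct)
    case (less n)
    show ?case
    proof (cases n)
      case 0
      thus ?thesis using assms(3) by simp
    next
      case (Suc k)
      have "fps_deriv f $ k = fps_deriv g $ k"
        unfolding assms(1,2) fps_mult_nth using less Suc by (intro sum.cong) auto
      hence "of_nat n * f $ n = of_nat n * g $ n" by (simp add: Suc)
      thus ?thesis by (rule of_nat_K1_cancel[rotated]) (simp add: Suc)
    qed
  qed
qed

lemma K1_exp_eqI:
  assumes "A $ 0 = 0" "f $ 0 = 1" "fps_deriv f = fps_deriv A * f"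
  shows "K1_exp A = f"
  by (rule K1_fps_ode_unique[of _ "fps_deriv A"]) (simp_all add: assms fps_deriv_K1_exp)

lemma K1_exp_add:
  assumes "A $ 0 = 0" "B $ 0 = 0"
  shows "K1_exp (A + B) = K1_exp A * K1_exp B"
  using assms by (intro K1_exp_eqI) (simp_all add: fps_deriv_K1_exp algebra_simps)

lemma K1_exp_0 [simp]: "K1_exp 0 = 1"
  by (rule K1_exp_eqI) simp_all

text \<open>The exponent is \<open>log (1 - a w)\<close>. Its term at \<open>r = 0\<close> is a
  division by zero, which has the value 0, so the constant term vanishes as needed.\<close>

lemma K1_exp_log:
  "K1_exp (Abs_fps (\<lambda>r. K1_const (- (a ^ r / of_nat r)))) = 1 - fps_const (K1_const a) * fps_X"
  (is "K1_exp ?A = ?f")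
proof (rule K1_exp_eqI)
  \<comment> \<open>The derivative is minus a geometric series, so multiplying it by
    \<open>1 - a w\<close> telescopes.\<close>
  have d: "fps_deriv ?A $ n = - (K1_const a ^ Suc n)" for n
  proof -
    have "of_nat (Suc n) * (- (a ^ Suc n / of_nat (Suc n))) = - (a ^ Suc n)"
      using of_nat_F_nonzero[of "Suc n"] by (simp del: of_nat_Suc power_Suc)
    hence "of_nat (Suc n) * K1_const (- (a ^ Suc n / of_nat (Suc n))) = K1_const (- (a ^ Suc n))"
      by (simp only: K1_const_mult[symmetric] K1_const_of_nat[symmetric])
    thus ?thesis by (simp add: K1_const_uminus K1_const_power del: of_nat_Suc power_Suc)
  qed
  show "fps_deriv ?f = fps_deriv ?A * ?f"
  proof (rule fps_ext)
    fix n
    show "fps_deriv ?f $ n = (fps_deriv ?A * ?f) $ n"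
      by (cases n) (simp_all add: d right_diff_distrib mult.assoc[symmetric]
          mult.commute[of _ "fps_const _"] del: fps_deriv_nth)
  qed
qed (simp_all)

lemma heis_deriv_fps_mult:
  fixes r :: nat
  defines "D \<equiv> \<lambda>f::K1 fps. Abs_fps (\<lambda>n. heis_deriv r (f $ n))"
  shows "D (f * g) = D f * g + f * D g"
  unfolding D_def
  by (rule fps_ext) (simp add: fps_mult_nth heis_deriv_sum heis_deriv_mult sum.distrib)

text \<open>The constant term is removed explicitly: by truncated subtraction
  \<open>heis_var 0\<close> is \<open>heis_var 1\<close>.\<close>

definition K1_creation :: "(nat \<Rightarrow> F) \<Rightarrow> K1 fps" where
  "K1_creation \<gamma> = Abs_fps (\<lambda>r. if r = 0 then 0 else K1_const (\<gamma> r) * heis_var r)"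

abbreviation creation_exp :: "(nat \<Rightarrow> F) \<Rightarrow> K1 fps" where
  "creation_exp \<gamma> \<equiv> K1_exp (K1_creation \<gamma>)"

lemma K1_creation_nth_0 [simp]: "K1_creation \<gamma> $ 0 = 0"
  by (simp add: K1_creation_def)

lemma creation_exp_add: "creation_exp (\<lambda>r. \<gamma> r + \<delta> r) = creation_exp \<gamma> * creation_exp \<delta>"
proof -
  have "K1_creation (\<lambda>r. \<gamma> r + \<delta> r) = K1_creation \<gamma> + K1_creation \<delta>"
    by (rule fps_ext) (simp add: K1_creation_def K1_const_add distrib_right)
  thus ?thesis by (simp add: K1_exp_add)
qed

lemma creation_exp_0: "creation_exp (\<lambda>r. 0) = 1"
proof -
  have "K1_creation (\<lambda>r. 0) = 0" by (rule fps_ext) (simp add: K1_creation_def)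
  thus ?thesis by simp
qed

text \<open>Since \<open>a(-r)\<close> always comes with \<open>z^r\<close>, replacing
  \<open>z\<close> by \<open>a z\<close> amounts to multiplying its weight by \<open>a^r\<close>.
  Dilations thus become changes of the weight function.\<close>

lemma creation_exp_dilate:
  "creation_exp (\<lambda>r. a ^ r * \<gamma> r) $ n = K1_const (a ^ n) * creation_exp \<gamma> $ n"
proof -
  have "(K1_creation (\<lambda>r. a ^ r * \<gamma> r) ^ k) $ n = K1_const (a ^ n) * (K1_creation \<gamma> ^ k) $ n" for k n
  proof (induction k arbitrary: n)
    case (Suc k)
    have "K1_creation (\<lambda>r. a ^ r * \<gamma> r) $ j * (K1_creation (\<lambda>r. a ^ r * \<gamma> r) ^ k) $ (n - j)
        = K1_const (a ^ n) * (K1_creation \<gamma> $ j * (K1_creation \<gamma> ^ k) $ (n - j))" if "j \<le> n" for j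
    proof -
      have *: "K1_const (a ^ n) = K1_const (a ^ j) * K1_const (a ^ (n - j))"
        using that by (simp flip: K1_const_mult power_add)
      have "K1_creation (\<lambda>r. a ^ r * \<gamma> r) $ j = K1_const (a ^ j) * K1_creation \<gamma> $ j"
        by (simp add: K1_creation_def K1_const_mult mult.assoc)
      thus ?thesis unfolding * Suc.IH by (simp only: mult_ac)
    qed
    thus ?case by (simp add: fps_mult_nth sum_distrib_left)
  qed auto
  thus ?thesis by (simp add: K1_exp_def sum_distrib_left mult_ac)
qed

text \<open>Coefficientwise, \<open>a(r)\<close> is a derivation that sends the exponent to the
  scalar monomial \<open>heis_level r * \<gamma> r * z^r\<close>; the rest is the power
  rule.\<close>

lemma heis_deriv_creation_power:
  assumes "r \<ge> 1"
  shows "heis_deriv r ((K1_creation \<gamma> ^ Suc k) $ n) =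
    (if r \<le> n then K1_const (of_nat (Suc k) * (heis_level r * \<gamma> r)) * (K1_creation \<gamma> ^ k) $ (n - r) else 0)"
proof -
  let ?D = "\<lambda>f::K1 fps. Abs_fps (\<lambda>n. heis_deriv r (f $ n))"
  let ?A = "K1_creation \<gamma>"
  let ?u = "fps_const (K1_const (heis_level r * \<gamma> r)) * fps_X ^ r"
  have D: "?D ?A = ?u"
  proof (rule fps_ext)
    fix n
    show "?D ?A $ n = ?u $ n"
      using assms
      by (cases "n = 0") (auto simp: K1_creation_def heis_deriv_const_mult heis_deriv_var'
          mult.commute[of "heis_level r"] simp flip: K1_const_mult)
  qed
  have "?D (?A ^ Suc k) = of_nat (Suc k) * ?u * ?A ^ k"
  proof (induction k)
    case 0
    show ?case using D by simp
  next
    case (Suc k)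
    have "?D (?A ^ Suc (Suc k)) = ?D ?A * ?A ^ Suc k + ?A * ?D (?A ^ Suc k)"
      unfolding power_Suc[of _ "Suc k"] by (rule heis_deriv_fps_mult)
    thus ?case unfolding D Suc by (simp add: algebra_simps)
  qed
  hence "heis_deriv r ((?A ^ Suc k) $ n) = (of_nat (Suc k) * ?u * ?A ^ k) $ n"
    by (metis fps_nth_Abs_fps)
  also have "of_nat (Suc k) * ?u * ?A ^ k =
      fps_const (K1_const (of_nat (Suc k) * (heis_level r * \<gamma> r))) * (fps_X ^ r * ?A ^ k)"
    by (simp add: K1_const_mult K1_const_of_nat fps_of_nat mult.assoc del: of_nat_Suc flip: fps_const_mult)
  finally show ?thesis by (simp add: fps_X_power_mult_nth del: of_nat_Suc)
qed

text \<open>The exponential is an eigenvector of \<open>a(r)\<close> with eigenvalue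
  \<open>heis_level r * \<gamma> r * z^r\<close>; the factor \<open>z^r\<close> shows up as a shift
  of the index.\<close>

lemma heis_deriv_creation_exp:
  assumes "r \<ge> 1"
  shows "heis_deriv r (creation_exp \<gamma> $ n) =
    (if r \<le> n then K1_const (heis_level r * \<gamma> r) * creation_exp \<gamma> $ (n - r) else 0)"
proof -
  let ?A = "K1_creation \<gamma>"
  let ?c = "\<lambda>k. 1 / of_nat (fact k) :: F"
  have "creation_exp \<gamma> $ n = (\<Sum>k\<le>Suc n. K1_const (?c k) * (?A ^ k) $ n)"
    by (rule K1_exp_nth) simp_all
  hence "heis_deriv r (creation_exp \<gamma> $ n) =
      (\<Sum>k\<le>Suc n. K1_const (?c k) * heis_deriv r ((?A ^ k) $ n))"
    by (simp only: heis_deriv_sum heis_deriv_const_mult)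
  also have "\<dots> = (\<Sum>k\<le>n. K1_const (?c (Suc k)) * heis_deriv r ((?A ^ Suc k) $ n))"
    using heis_deriv_const[of r 1]
    by (subst sum.atMost_Suc_shift) (auto simp del: power_Suc of_nat_Suc fact_Suc heis_deriv_const)
  also have "\<dots> = (if r \<le> n then K1_const (heis_level r * \<gamma> r) *
      (\<Sum>k\<le>n. K1_const (?c k) * (?A ^ k) $ (n - r)) else 0)"
  proof (cases "r \<le> n")
    case True
    have "K1_const (?c (Suc k)) * heis_deriv r ((?A ^ Suc k) $ n)
      = K1_const (heis_level r * \<gamma> r) * (K1_const (?c k) * (?A ^ k) $ (n - r))" for k
    proof -
      have "K1_const (?c (Suc k)) * K1_const (of_nat (Suc k) * (heis_level r * \<gamma> r))
          = K1_const (heis_level r * \<gamma> r) * K1_const (?c k)"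
        unfolding K1_const_mult[symmetric] mult.assoc[symmetric] inverse_fact_Suc by (simp only: mult_ac)
      thus ?thesis
        unfolding heis_deriv_creation_power[OF assms] if_P[OF True] mult.assoc[symmetric] by simp
    qed
    thus ?thesis using True by (simp add: sum_distrib_left del: power_Suc of_nat_Suc fact_Suc)
  qed (simp add: heis_deriv_creation_power[OF assms] del: power_Suc of_nat_Suc fact_Suc)
  also have "(\<Sum>k\<le>n. K1_const (?c k) * (?A ^ k) $ (n - r)) = creation_exp \<gamma> $ (n - r)"
    by (rule K1_exp_nth[symmetric]) simp_all
  finally show ?thesis .
qed

section \<open>Vertex operators on exponentials\<close>

lemma scalar_single: "scalar c * Poly_Mapping.single m f = Poly_Mapping.single m (K1_const c * f)"
  by (simp add: scalar_def K1_const_def mult_single)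

lemma a_neg_single: "a_neg r (Poly_Mapping.single m f) = Poly_Mapping.single m (heis_var r * f)"
  by (simp add: a_neg_def mult_single)

lemma a_pos_single: "a_pos r (Poly_Mapping.single m f) = Poly_Mapping.single m (heis_deriv r f)"
  by (simp add: a_pos_def)

lemma single_sum: "Poly_Mapping.single m (\<Sum>x\<in>A. f x) = (\<Sum>x\<in>A. Poly_Mapping.single m (f x))"
  by (induction A rule: infinite_finite_induct) (simp_all add: single_add)

lemma sum_atLeast1_eq: "f 0 = 0 \<Longrightarrow> (\<Sum>r=1..n. f r) = (\<Sum>r=0..(n::nat). f r)"
  by (simp add: sum.atLeast_Suc_atMost[of 0 n])

lemma op_pow_neg_single:
  "op_pow (\<lambda>r u. scalar (c r) * a_neg r u) k n (Poly_Mapping.single m f) =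
     Poly_Mapping.single m ((K1_creation c ^ k) $ n * f)"
proof (induction k arbitrary: n)
  case (Suc k)
  have "(\<Sum>r=1..n. K1_creation c $ r * ((K1_creation c ^ k) $ (n - r) * f)) =
      (K1_creation c ^ Suc k) $ n * f"
    by (subst sum_atLeast1_eq) (simp_all add: fps_mult_nth sum_distrib_right mult.assoc)
  moreover have "(\<Sum>r=1..n. K1_creation c $ r * ((K1_creation c ^ k) $ (n - r) * f)) =
      (\<Sum>r=1..n. K1_const (c r) * (heis_var r * ((K1_creation c ^ k) $ (n - r) * f)))"
    by (intro sum.cong) (auto simp: K1_creation_def mult.assoc)
  ultimately show ?case
    by (simp add: Suc a_neg_single scalar_single single_sum[symmetric] del: power_Suc)
qed simp

lemma op_exp_neg_single:
  "op_exp (\<lambda>r u. scalar (c r) * a_neg r u) n (Poly_Mapping.single m f) =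
     Poly_Mapping.single m (creation_exp c $ n * f)"
  by (simp add: op_exp_def op_pow_neg_single scalar_single single_sum[symmetric]
      K1_exp_def sum_distrib_right mult.assoc)

text \<open>Extending by zero to negative indices lets degrees be shifted without case
  distinctions.\<close>

definition creation_coeff :: "(nat \<Rightarrow> F) \<Rightarrow> int \<Rightarrow> K1" where
  "creation_coeff \<gamma> k = (if k \<ge> 0 then creation_exp \<gamma> $ nat k else 0)"

lemma creation_coeff_neg [simp]: "k < 0 \<Longrightarrow> creation_coeff \<gamma> k = 0"
  by (simp add: creation_coeff_def)

lemma heis_deriv_creation_coeff:
  assumes "r \<ge> 1"
  shows "heis_deriv r (creation_coeff \<gamma> k) = K1_const (heis_level r * \<gamma> r) * creation_coeff \<gamma> (k - int r)"
proof -
  have "nat k - r = nat (k - int r)" if "r \<le> nat k" using that by linarith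
  thus ?thesis
    using assms by (auto simp: creation_coeff_def heis_deriv_creation_exp)
qed

text \<open>Moving the annihilation half with weights \<open>c\<close> in \<open>z1\<close> past the
  exponential with weights \<open>\<gamma>\<close> in \<open>z2\<close> costs the exponential of
  this series in \<open>w = z2 / z1\<close>.\<close>

definition contraction_log :: "(nat \<Rightarrow> F) \<Rightarrow> (nat \<Rightarrow> F) \<Rightarrow> K1 fps" where
  "contraction_log c \<gamma> = Abs_fps (\<lambda>r. if r = 0 then 0 else K1_const (- (c r * heis_level r * \<gamma> r)))"

abbreviation contraction :: "(nat \<Rightarrow> F) \<Rightarrow> (nat \<Rightarrow> F) \<Rightarrow> K1 fps" where
  "contraction c \<gamma> \<equiv> K1_exp (contraction_log c \<gamma>)"

lemma contraction_log_nth_0 [simp]: "contraction_log c \<gamma> $ 0 = 0"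
  by (simp add: contraction_log_def)

lemma heis_deriv_contraction_log_power [simp]: "heis_deriv r ((contraction_log c \<gamma> ^ k) $ n) = 0"
proof (induction k arbitrary: n)
  case 0
  show ?case using heis_deriv_const[of r 1] by (simp del: heis_deriv_const)
next
  case (Suc k)
  have "heis_deriv r (contraction_log c \<gamma> $ j) = 0" for j
    by (simp add: contraction_log_def)
  thus ?case by (simp add: fps_mult_nth heis_deriv_sum heis_deriv_mult Suc)
qed

text \<open>The factors \<open>u\<close> lie in \<open>K1\<close> because contractions are series
  over \<open>K1\<close>; the lemmas on the annihilation half ask that every \<open>a(r)\<close>
  kills them.\<close>

definition creation_comb :: "'e set \<Rightarrow> ('e \<Rightarrow> K1) \<Rightarrow> ('e \<Rightarrow> nat \<Rightarrow> F) \<Rightarrow> int \<Rightarrow> K1" where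
  "creation_comb T u \<gamma> N = (\<Sum>e\<in>T. u e * creation_coeff (\<gamma> e) N)"

text \<open>Each \<open>a(r)\<close> with its scalar lowers the index of an exponential by
  \<open>r\<close> and multiplies it by coefficient \<open>r\<close> of
  \<open>contraction_log\<close>. Modes of total \<open>n\<close> over \<open>k\<close> factors
  build up coefficient \<open>n\<close> of the \<open>k\<close>-th power.\<close>

lemma op_pow_pos_single:
  assumes "\<And>e r. e \<in> T \<Longrightarrow> heis_deriv r (u e) = 0"
  shows "op_pow (\<lambda>r u. scalar (- c r) * a_pos r u) k n (Poly_Mapping.single m (creation_comb T u \<gamma> N)) =
     Poly_Mapping.single m (creation_comb T (\<lambda>e. u e * (contraction_log c (\<gamma> e) ^ k) $ n) \<gamma> (N - int n))"
proof (induction k arbitrary: n)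
  case (Suc k)
  let ?A = "\<lambda>e. contraction_log c (\<gamma> e)"
  have *: "K1_const (- c r) * heis_deriv r (u e * (?A e ^ k) $ (n - r) * creation_coeff (\<gamma> e) (N - int (n - r)))
      = u e * (?A e $ r * (?A e ^ k) $ (n - r)) * creation_coeff (\<gamma> e) (N - int n)"
    if "e \<in> T" "r \<in> {1..n}" for e r
  proof -
    have 1: "N - int (n - r) - int r = N - int n" using that by auto
    have 2: "?A e $ r = K1_const (- c r) * K1_const (heis_level r * \<gamma> e r)"
      using that by (simp add: contraction_log_def mult.assoc flip: K1_const_mult)
    have "heis_deriv r (u e * (?A e ^ k) $ (n - r) * creation_coeff (\<gamma> e) (N - int (n - r)))
      = u e * (?A e ^ k) $ (n - r) * (K1_const (heis_level r * \<gamma> e r) * creation_coeff (\<gamma> e) (N - int n))"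
      using that by (simp add: heis_deriv_mult assms heis_deriv_creation_coeff 1)
    thus ?thesis unfolding 2 by (simp only: mult_ac)
  qed
  have "op_pow (\<lambda>r u. scalar (- c r) * a_pos r u) (Suc k) n (Poly_Mapping.single m (creation_comb T u \<gamma> N))
     = Poly_Mapping.single m (\<Sum>r=1..n. \<Sum>e\<in>T. K1_const (- c r) *
         heis_deriv r (u e * (?A e ^ k) $ (n - r) * creation_coeff (\<gamma> e) (N - int (n - r))))"
    unfolding op_pow.simps Suc a_pos_single scalar_single single_sum[symmetric]
    unfolding creation_comb_def heis_deriv_sum sum_distrib_left ..
  also have "(\<Sum>r=1..n. \<Sum>e\<in>T. K1_const (- c r) *
         heis_deriv r (u e * (?A e ^ k) $ (n - r) * creation_coeff (\<gamma> e) (N - int (n - r))))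
      = (\<Sum>r=1..n. \<Sum>e\<in>T. u e * (?A e $ r * (?A e ^ k) $ (n - r)) * creation_coeff (\<gamma> e) (N - int n))"
    using * by (intro sum.cong refl) blast
  also have "\<dots> = (\<Sum>e\<in>T. u e * (\<Sum>r=1..n. ?A e $ r * (?A e ^ k) $ (n - r)) * creation_coeff (\<gamma> e) (N - int n))"
    by (subst sum.swap) (simp only: sum_distrib_left sum_distrib_right)
  also have "(\<lambda>e. \<Sum>r=1..n. ?A e $ r * (?A e ^ k) $ (n - r)) = (\<lambda>e. (?A e ^ Suc k) $ n)"
    by (rule ext, subst sum_atLeast1_eq) (simp_all add: fps_mult_nth)
  finally show ?case unfolding creation_comb_def .
qed (simp add: creation_comb_def)

lemma op_exp_pos_single:
  assumes "\<And>e r. e \<in> T \<Longrightarrow> heis_deriv r (u e) = 0"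
  shows "op_exp (\<lambda>r u. scalar (- c r) * a_pos r u) n (Poly_Mapping.single m (creation_comb T u \<gamma> N)) =
     Poly_Mapping.single m (creation_comb T (\<lambda>e. u e * contraction c (\<gamma> e) $ n) \<gamma> (N - int n))"
proof -
  have "(\<Sum>k\<le>n. K1_const (1 / of_nat (fact k)) *
        creation_comb T (\<lambda>e. u e * (contraction_log c (\<gamma> e) ^ k) $ n) \<gamma> (N - int n))
    = creation_comb T (\<lambda>e. u e * contraction c (\<gamma> e) $ n) \<gamma> (N - int n)"
    unfolding creation_comb_def K1_exp_def fps_nth_Abs_fps sum_distrib_left sum_distrib_right
    by (subst sum.swap) (simp only: mult_ac)
  thus ?thesis
    by (simp add: op_exp_def op_pow_pos_single[OF assms] scalar_single flip: single_sum)
qed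

lemma exp_neg_nth:
  "exp_neg c (Poly_Mapping.single m f) $$ k = Poly_Mapping.single m (creation_coeff c k * f)"
proof -
  have "exp_neg c (Poly_Mapping.single m f) $$ k =
      (if k \<ge> 0 then op_exp (\<lambda>r u. scalar (c r) * a_neg r u) (nat k) (Poly_Mapping.single m f) else 0)"
    unfolding exp_neg_def by (rule nth_Abs_fls_lower_bound[of 0]) simp
  thus ?thesis by (simp add: op_exp_neg_single creation_coeff_def)
qed

lemma creation_comb_neg: "N < 0 \<Longrightarrow> creation_comb T u \<gamma> N = 0"
  by (simp add: creation_comb_def)

lemma exp_pos_nth:
  assumes "\<And>e r. e \<in> T \<Longrightarrow> heis_deriv r (u e) = 0"
  shows "exp_pos c (Poly_Mapping.single m (creation_comb T u \<gamma> N)) $$ k =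
    (if k \<le> 0
     then Poly_Mapping.single m (creation_comb T (\<lambda>e. u e * contraction c (\<gamma> e) $ nat (- k)) \<gamma> (N + k))
     else 0)"
proof -
  have "exp_pos c (Poly_Mapping.single m (creation_comb T u \<gamma> N)) $$ k =
      (if k \<le> 0 then op_exp (\<lambda>r u. scalar (- c r) * a_pos r u) (nat (- k))
        (Poly_Mapping.single m (creation_comb T u \<gamma> N)) else 0)"
    unfolding exp_pos_def
    \<comment> \<open>Annihilation operators of total mode above \<open>N\<close> kill a coefficient
      of index \<open>N\<close>, so no power of \<open>z\<close> below \<open>- N\<close>
      occurs.\<close>
    by (rule nth_Abs_fls_lower_bound[of "- N"])
       (auto simp: op_exp_pos_single[OF assms] creation_comb_neg)
  thus ?thesis by (simp add: op_exp_pos_single[OF assms])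
qed

text \<open>The bound \<open>B\<close> ensures that the coefficients form a Laurent series, so that
  \<open>Abs_fls\<close> can be undone; \<open>A\<close> contains the support of the sum.\<close>

lemma op_mult_nth:
  assumes "\<And>k j. k < B \<Longrightarrow> a (b v $$ j) $$ (k - j) = 0"
    and "finite A" and "\<And>j. j \<notin> A \<Longrightarrow> a (b v $$ j) $$ (k - j) = 0"
  shows "op_mult a b v $$ k = (\<Sum>j\<in>A. a (b v $$ j) $$ (k - j))"
proof -
  have "op_mult a b v $$ k = Sum_any (\<lambda>j. a (b v $$ j) $$ (k - j))"
    unfolding op_mult_def using assms(1) by (intro nth_Abs_fls_lower_bound[of B]) simp
  also have "\<dots> = (\<Sum>j\<in>A. a (b v $$ j) $$ (k - j))"
    using assms(2,3) by (intro Sum_any.expand_superset) auto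
  finally show ?thesis .
qed

lemma exp_pos_0_nth: "exp_pos c 0 $$ k = 0"
  using exp_pos_nth[of "{} :: unit set" "\<lambda>_. 0" c 0 "\<lambda>_ _. 0" 0 k] by (simp add: creation_comb_def)

text \<open>The lattice part gives \<open>z^d\<close> and the contraction is a polynomial of degree
  at most \<open>d\<close>, so before the creation half acts only \<open>z^0, ..., z^d\<close>
  occur. The index \<open>t\<close> is the degree taken from the contraction.\<close>

lemma vertex_operator_nth:
  assumes u: "\<And>e r. e \<in> T \<Longrightarrow> heis_deriv r (u e) = 0"
    and lat: "\<And>j. lat v $$ j = (if j = int d then Poly_Mapping.single m (creation_comb T u \<gamma> N) else 0)"
    and deg: "\<And>e t. e \<in> T \<Longrightarrow> t > d \<Longrightarrow> contraction c (\<gamma> e) $ t = 0"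
  shows "op_mult (exp_neg c) (op_mult (exp_pos c) lat) v $$ k =
    Poly_Mapping.single m (\<Sum>t\<le>d. creation_coeff c (k - int d + int t) *
      creation_comb T (\<lambda>e. u e * contraction c (\<gamma> e) $ t) \<gamma> (N - int t))"
proof -
  let ?P = "\<lambda>t. creation_comb T (\<lambda>e. u e * contraction c (\<gamma> e) $ t) \<gamma> (N - int t)"
  have inner: "op_mult (exp_pos c) lat v $$ k =
      Poly_Mapping.single m (if k \<in> {0..int d} then ?P (nat (int d - k)) else 0)" for k
  proof -
    have P0: "?P t = 0" if "t > d" for t
      unfolding creation_comb_def using deg that by (intro sum.neutral) simp
    have "op_mult (exp_pos c) lat v $$ k = (\<Sum>j\<in>{int d}. exp_pos c (lat v $$ j) $$ (k - j))"
      by (rule op_mult_nth[of "min (int d) (int d - N)"])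
         (auto simp: lat exp_pos_0_nth exp_pos_nth[OF u] creation_comb_neg)
    also have "\<dots> = Poly_Mapping.single m (if k \<in> {0..int d} then ?P (nat (int d - k)) else 0)"
      using P0[of "nat (int d - k)"] by (auto simp: lat exp_pos_nth[OF u] algebra_simps)
    finally show ?thesis .
  qed
  have "op_mult (exp_neg c) (op_mult (exp_pos c) lat) v $$ k =
      (\<Sum>j\<in>{0..int d}. exp_neg c (op_mult (exp_pos c) lat v $$ j) $$ (k - j))"
    by (rule op_mult_nth[of 0]) (auto simp: inner exp_neg_nth)
  also have "\<dots> = (\<Sum>j\<in>{0..int d}. Poly_Mapping.single m (creation_coeff c (k - j) * ?P (nat (int d - j))))"
    by (intro sum.cong refl) (simp only: inner exp_neg_nth if_True)
  also have "\<dots> = (\<Sum>t\<le>d. Poly_Mapping.single m (creation_coeff c (k - int d + int t) * ?P t))"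
    by (rule sum.reindex_bij_witness[of _ "\<lambda>t. int d - int t" "\<lambda>j. nat (int d - j)"])
       (auto simp: algebra_simps)
  finally show ?thesis by (simp add: single_sum)
qed

lemma lattice_x_single_nth:
  "lattice_x i (Poly_Mapping.single n f) $$ j =
     (if j = 2 * n + int i then Poly_Mapping.single (n + 1) f else 0)"
  by (cases "f = 0") (auto simp: lattice_x_def)

lemma lattice_Y_single_nth:
  "lattice_Y (Poly_Mapping.single 0 f) $$ j = (if j = 0 then Poly_Mapping.single 0 f else 0)"
  by (cases "f = 0") (auto simp: lattice_Y_def)

lemma frenkel_jing_nth:
  assumes "\<And>e r. e \<in> T \<Longrightarrow> heis_deriv r (u e) = 0"
    and "\<And>e t. e \<in> T \<Longrightarrow> t > 2 * n + i \<Longrightarrow> contraction fj_coeff (\<gamma> e) $ t = 0"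
  shows "frenkel_jing i (Poly_Mapping.single (int n) (creation_comb T u \<gamma> N)) $$ k =
    Poly_Mapping.single (int n + 1) (\<Sum>t\<le>2 * n + i. creation_coeff fj_coeff (k - int (2 * n + i) + int t) *
      creation_comb T (\<lambda>e. u e * contraction fj_coeff (\<gamma> e) $ t) \<gamma> (N - int t))"
proof -
  have "(\<lambda>r. inverse sqrt_q ^ r / qint r) = fj_coeff"
    by (simp add: fj_coeff_def fun_eq_iff)
  thus ?thesis
    unfolding frenkel_jing_def Let_def using assms
    by (simp only:) (rule vertex_operator_nth, simp_all add: lattice_x_single_nth)
qed

text \<open>Every \<open>a(r)\<close> kills the vacuum and its lattice exponent is 0, so only the
  creation half remains. The vacuum enters as the coefficient of index 0 of the exponential with
  zero weight.\<close>

lemma koyama_vacuum_nth: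
  "koyama (Poly_Mapping.single 0 1) $$ k = Poly_Mapping.single 0 (creation_coeff koyama_coeff k)"
proof -
  let ?T = "{()}" and ?u = "\<lambda>_. 1 :: K1" and ?g = "\<lambda>_ _. 0 :: F"
  have u: "heis_deriv r 1 = 0" for r using heis_deriv_const[of r 1] by simp
  have comb: "creation_comb ?T ?u ?g 0 = 1"
    by (simp add: creation_comb_def creation_coeff_def)
  have c0: "contraction_log c (\<lambda>_. 0) = 0" for c
    by (rule fps_ext) (simp add: contraction_log_def)
  have "(\<lambda>r. sqrt_q ^ r / qint (2 * r)) = koyama_coeff"
    by (simp add: koyama_coeff_def fun_eq_iff)
  hence "koyama (Poly_Mapping.single 0 1) =
      op_mult (exp_neg koyama_coeff) (op_mult (exp_pos koyama_coeff) lattice_Y)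
        (Poly_Mapping.single 0 (creation_comb ?T ?u ?g 0))"
    unfolding koyama_def Let_def comb by simp
  moreover have "\<dots> $$ k = Poly_Mapping.single 0 (\<Sum>t\<le>0. creation_coeff koyama_coeff (k - int 0 + int t) *
      creation_comb ?T (\<lambda>e. ?u e * contraction koyama_coeff (?g e) $ t) ?g (0 - int t))"
    by (rule vertex_operator_nth) (simp_all add: u lattice_Y_single_nth c0)
  ultimately show ?thesis using comb by (simp add: c0)
qed

section \<open>The product with a mode of the Frenkel--Jing operator\<close>

lemma op_dilate_nth: "op_dilate c b v $$ j = scalar (c powi j) * b v $$ j"
proof -
  have "\<forall>j < fls_subdegree (b v). scalar (c powi j) * b v $$ j = 0" by simp
  thus ?thesis unfolding op_dilate_def by (rule nth_Abs_fls_lower_bound)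
qed

text \<open>The \<open>n\<close>-th \<open>qq\<close>-derivative multiplies the coefficient of
  \<open>z^K\<close> by the product of \<open>(qq^(K-s) - 1) / (qq - 1)\<close> over
  \<open>s < n\<close>. This is that product as a polynomial in \<open>qq^K\<close>, whose monomial
  of degree \<open>h\<close> is the dilation by \<open>qq^h\<close>.\<close>

definition q_deriv_poly :: "nat \<Rightarrow> F poly" where
  "q_deriv_poly n = (\<Prod>s<n. [:- 1 / (qq - 1), inverse qq ^ s / (qq - 1):])"

lemma degree_q_deriv_poly: "degree (q_deriv_poly n) \<le> n"
proof (induction n)
  case (Suc n)
  have "degree (q_deriv_poly (Suc n)) \<le>
      degree (q_deriv_poly n) + degree [:- 1 / (qq - 1), inverse qq ^ n / (qq - 1):]"
    unfolding q_deriv_poly_def prod.lessThan_Suc by (rule degree_mult_le)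
  also have "\<dots> \<le> n + 1"
    using Suc by (intro add_mono) auto
  finally show ?case by simp
qed (simp add: q_deriv_poly_def)

text \<open>At 0 each factor is \<open>- 1 / (qq - 1)\<close>. This coefficient belongs to the
  undilated operator, the term \<open>h = 0\<close>.\<close>

lemma coeff_q_deriv_poly_0: "coeff (q_deriv_poly n) 0 \<noteq> 0"
  by (simp add: q_deriv_poly_def poly_prod flip: poly_0_coeff_0)

lemma poly_q_deriv_poly: "poly (q_deriv_poly n) x = (\<Sum>h\<le>n. coeff (q_deriv_poly n) h * x ^ h)"
  unfolding poly_altdef using degree_q_deriv_poly[of n]
  by (intro sum.mono_neutral_left) (auto simp: coeff_eq_0)

lemma q_deriv_nth:
  "q_deriv a v $$ k = scalar ((qq powi (k + 1) - 1) / (qq - 1)) * a v $$ (k + 1)"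
proof -
  have "scalar ((qq powi (k + 1) - 1) / (qq - 1)) =
      scalar (1 / (qq - 1)) * (scalar (qq powi (k + 1)) - scalar 1)"
  proof -
    have "scalar (c - d) = scalar c - scalar d" for c d
      by (simp add: scalar_def single_diff)
    hence "scalar (1 / (qq - 1)) * (scalar (qq powi (k + 1)) - scalar 1) =
        scalar (1 / (qq - 1) * (qq powi (k + 1) - 1))"
      by (simp only: scalar_mult)
    thus ?thesis by (simp only: times_divide_eq_left mult_1)
  qed
  thus ?thesis
    by (simp add: q_deriv_def op_dilate_nth left_diff_distrib mult.assoc right_diff_distrib)
qed

lemma q_deriv_power_nth:
  "(q_deriv ^^ n) a v $$ k = scalar (poly (q_deriv_poly n) (qq powi (k + int n))) * a v $$ (k + int n)"
proof (induction n arbitrary: k)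
  case 0
  show ?case by (simp add: q_deriv_poly_def)
next
  case (Suc n)
  let ?K = "k + 1 + int n"
  have "inverse qq ^ n * qq powi ?K = qq powi (k + 1)"
  proof -
    have "inverse qq ^ n = qq powi (- int n)" by (simp add: power_int_minus power_inverse)
    thus ?thesis by (simp flip: power_int_add)
  qed
  hence "- 1 / (qq - 1) + qq powi ?K * (inverse qq ^ n / (qq - 1)) = (qq powi (k + 1) - 1) / (qq - 1)"
    by (simp add: diff_divide_distrib mult.commute)
  hence "poly (q_deriv_poly (Suc n)) (qq powi ?K) =
      (qq powi (k + 1) - 1) / (qq - 1) * poly (q_deriv_poly n) (qq powi ?K)"
    unfolding q_deriv_poly_def prod.lessThan_Suc poly_mult
    by (simp only: poly_pCons poly_0 mult_zero_left mult_zero_right add_0_right mult.commute)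
  moreover have "k + int (Suc n) = ?K" by simp
  ultimately show ?case
    by (simp only: funpow.simps comp_def q_deriv_nth Suc scalar_mult mult.assoc)
qed

lemma creation_coeff_dilate:
  "creation_coeff (\<lambda>r. a ^ r * \<gamma> r) k = K1_const (a powi k) * creation_coeff \<gamma> k"
  by (simp add: creation_coeff_def creation_exp_dilate power_int_def)

lemma creation_coeff_convolution:
  assumes "finite A" and "{0..M} \<subseteq> A"
  shows "(\<Sum>a\<in>A. creation_coeff \<gamma> (M - a) * creation_coeff \<delta> a) = creation_coeff (\<lambda>r. \<gamma> r + \<delta> r) M"
proof -
  have "(\<Sum>a\<in>A. creation_coeff \<gamma> (M - a) * creation_coeff \<delta> a) =
      (\<Sum>a\<in>{0..M}. creation_coeff \<gamma> (M - a) * creation_coeff \<delta> a)"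
    using assms by (intro sum.mono_neutral_right) auto
  also have "\<dots> = creation_coeff (\<lambda>r. \<gamma> r + \<delta> r) M"
  proof (cases "M \<ge> 0")
    case True
    have "(\<Sum>a\<in>{0..M}. creation_coeff \<gamma> (M - a) * creation_coeff \<delta> a) =
        (\<Sum>b=0..nat M. creation_exp \<gamma> $ b * creation_exp \<delta> $ (nat M - b))"
      by (rule sum.reindex_bij_witness[of _ "\<lambda>b. M - int b" "\<lambda>a. nat (M - a)"])
         (use True in \<open>auto simp: creation_coeff_def nat_diff_distrib\<close>)
    thus ?thesis using True by (simp add: creation_coeff_def creation_exp_add fps_mult_nth)
  qed simp
  finally show ?thesis .
qed

lemma sum_reverse4:
  "(\<Sum>j\<in>A. \<Sum>t\<in>B. \<Sum>e\<in>C. \<Sum>h\<in>D. f j t e h) = (\<Sum>h\<in>D. \<Sum>e\<in>C. \<Sum>t\<in>B. \<Sum>j\<in>A. f j t e h)"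
proof -
  have "(\<Sum>j\<in>A. \<Sum>t\<in>B. \<Sum>e\<in>C. \<Sum>h\<in>D. f j t e h) = (\<Sum>j\<in>A. \<Sum>h\<in>D. \<Sum>e\<in>C. \<Sum>t\<in>B. f j t e h)"
    by (simp only: sum.swap[of _ D] sum.swap[of _ C B])
  also have "\<dots> = (\<Sum>h\<in>D. \<Sum>e\<in>C. \<Sum>t\<in>B. \<Sum>j\<in>A. f j t e h)"
    by (simp only: sum.swap[of _ _ A])
  finally show ?thesis .
qed

text \<open>The coefficient of the passage from a label \<open>e\<close> to
  \<open>h # map ((+) n) e\<close>, where \<open>p\<close> lists the contraction coefficients. The
  sum is the contraction polynomial at the ratio \<open>qq^n / qq^h\<close> of the two dilations,
  homogenised in degree \<open>d\<close>.\<close>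

definition step_coeff :: "nat \<Rightarrow> int \<Rightarrow> nat \<Rightarrow> (nat \<Rightarrow> F) \<Rightarrow> nat \<Rightarrow> F" where
  "step_coeff n \<sigma> d p h =
     coeff (q_deriv_poly n) h * (qq ^ n) powi \<sigma> / qqfact n * (\<Sum>t\<le>d. p t * (qq ^ n) ^ t * (qq ^ h) ^ (d - t))"

text \<open>Splitting the derivative into dilations gives the sum over \<open>h\<close>. For fixed
  \<open>h\<close>, \<open>e\<close> and \<open>t\<close>, all powers depending on \<open>j\<close>
  are absorbed as dilations, and the sum over \<open>j\<close> becomes the product of two
  exponentials, whose weights add.\<close>

lemma x_prod_nth:
  fixes T :: "'e set" and w :: "'e \<Rightarrow> F" and p :: "'e \<Rightarrow> nat \<Rightarrow> F"
  assumes d_def: "d = 2 * m + i"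
    and b: "\<And>j. b v $$ j = Poly_Mapping.single (int m) (creation_comb T (\<lambda>e. K1_const (w e)) \<gamma> (j - \<sigma>))"
    and p: "\<And>e t. e \<in> T \<Longrightarrow> contraction fj_coeff (\<gamma> e) $ t = K1_const (p e t)"
    and deg: "\<And>e t. e \<in> T \<Longrightarrow> t > d \<Longrightarrow> p e t = 0"
    and n: "n = nat (- l - 1)"
  shows "x_prod i l b v $$ k = Poly_Mapping.single (int m + 1)
    (\<Sum>h\<le>n. \<Sum>e\<in>T. K1_const (step_coeff n \<sigma> d (p e) h * w e) *
      creation_coeff (\<lambda>r. (qq ^ h) ^ r * fj_coeff r + (qq ^ n) ^ r * \<gamma> e r) (k - (\<sigma> + int d - int n)))"
proof -
  define A where "A = qq ^ n"
  define M where "M = k - (\<sigma> + int d - int n)"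
  define J where "J = {\<sigma>..k + int n}"
  let ?x = "(q_deriv ^^ n) (frenkel_jing i)"
  have A0: "A \<noteq> 0" by (simp add: A_def)
  have dil: "op_dilate A b v $$ j =
      Poly_Mapping.single (int m) (creation_comb T (\<lambda>e. K1_const (A powi j * w e)) \<gamma> (j - \<sigma>))" for j
    by (simp add: op_dilate_nth b scalar_single creation_comb_def sum_distrib_left K1_const_mult mult.assoc)
  define summand where "summand = (\<lambda>k j t e.
      K1_const (A powi j * w e * p e t) * (creation_coeff fj_coeff (k - j + int n - int d + int t) *
        creation_coeff (\<gamma> e) (j - \<sigma> - int t)))"
  have x: "?x (op_dilate A b v $$ j) $$ (k - j) = Poly_Mapping.single (int m + 1)
      (K1_const (poly (q_deriv_poly n) (qq powi (k - j + int n))) * (\<Sum>t\<le>d. \<Sum>e\<in>T. summand k j t e))" for k j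
  proof -
    have "frenkel_jing i (op_dilate A b v $$ j) $$ (k - j + int n) =
      Poly_Mapping.single (int m + 1) (\<Sum>t\<le>2 * m + i.
        creation_coeff fj_coeff (k - j + int n - int (2 * m + i) + int t) *
        creation_comb T (\<lambda>e. K1_const (A powi j * w e) * contraction fj_coeff (\<gamma> e) $ t) \<gamma> (j - \<sigma> - int t))"
      unfolding dil by (rule frenkel_jing_nth) (use deg in \<open>simp_all add: p d_def\<close>)
    also have "(\<Sum>t\<le>2 * m + i.
        creation_coeff fj_coeff (k - j + int n - int (2 * m + i) + int t) *
        creation_comb T (\<lambda>e. K1_const (A powi j * w e) * contraction fj_coeff (\<gamma> e) $ t) \<gamma> (j - \<sigma> - int t))
      = (\<Sum>t\<le>d. \<Sum>e\<in>T. summand k j t e)"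
      unfolding creation_comb_def sum_distrib_left d_def[symmetric]
    proof (intro sum.cong refl)
      fix t e assume "e \<in> T"
      show "creation_coeff fj_coeff (k - j + int n - int d + int t) *
          (K1_const (A powi j * w e) * contraction fj_coeff (\<gamma> e) $ t * creation_coeff (\<gamma> e) (j - \<sigma> - int t))
          = summand k j t e"
        unfolding summand_def p[OF \<open>e \<in> T\<close>] K1_const_mult by (simp only: mult_ac)
    qed
    finally show ?thesis unfolding q_deriv_power_nth by (simp only: scalar_single)
  qed
  \<comment> \<open>Outside \<open>J\<close>, which is empty for \<open>k < \<sigma> - n\<close>,
    one of the two creation coefficients has a negative index.\<close>
  have summand0: "summand k j t e = 0" if "k < \<sigma> - int n \<or> j \<notin> {\<sigma>..k + int n}" "t \<le> d" for k j t e
  proof -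
    have "k - j + int n - int d + int t < 0 \<or> j - \<sigma> - int t < 0"
      using that by auto
    thus ?thesis unfolding summand_def by auto
  qed
  have "op_mult ?x (op_dilate A b) v $$ k = (\<Sum>j\<in>J. ?x (op_dilate A b v $$ j) $$ (k - j))"
    by (rule op_mult_nth[of "\<sigma> - int n"]) (simp_all add: x summand0 J_def)
  also have "\<dots> = Poly_Mapping.single (int m + 1)
      (\<Sum>j\<in>J. \<Sum>t\<le>d. \<Sum>e\<in>T. \<Sum>h\<le>n.
        K1_const (coeff (q_deriv_poly n) h * (qq powi (k - j + int n)) ^ h) * summand k j t e)"
    unfolding x poly_q_deriv_poly single_sum[symmetric] sum_distrib_left K1_const_sum sum_distrib_right ..
  also have "(\<Sum>j\<in>J. \<Sum>t\<le>d. \<Sum>e\<in>T. \<Sum>h\<le>n.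
        K1_const (coeff (q_deriv_poly n) h * (qq powi (k - j + int n)) ^ h) * summand k j t e)
    = (\<Sum>h\<le>n. \<Sum>e\<in>T. \<Sum>t\<le>d. \<Sum>j\<in>J.
        K1_const (coeff (q_deriv_poly n) h * (qq powi (k - j + int n)) ^ h) * summand k j t e)"
    by (rule sum_reverse4)
  also have "\<dots> = (\<Sum>h\<le>n. \<Sum>e\<in>T. \<Sum>t\<le>d.
      K1_const (coeff (q_deriv_poly n) h * A powi \<sigma> * (p e t * A ^ t * (qq ^ h) ^ (d - t)) * w e) *
      creation_coeff (\<lambda>r. (qq ^ h) ^ r * fj_coeff r + A ^ r * \<gamma> e r) M)"
  proof (intro sum.cong refl)
    fix h e t assume t: "t \<in> {..d}"
    define C where "C = coeff (q_deriv_poly n) h * A powi \<sigma> * (p e t * A ^ t * (qq ^ h) ^ (d - t)) * w e"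
    let ?f = "\<lambda>r. (qq ^ h) ^ r * fj_coeff r" and ?g = "\<lambda>r. A ^ r * \<gamma> e r"
    have *: "K1_const (coeff (q_deriv_poly n) h * (qq powi (k - j + int n)) ^ h) * summand k j t e =
        K1_const C * (creation_coeff ?f (M - (j - \<sigma> - int t)) * creation_coeff ?g (j - \<sigma> - int t))" for j
    proof -
      \<comment> \<open>The old and the new exponential contribute the indices \<open>a\<close> and
        \<open>M - a\<close>; the powers of \<open>qq\<close> are split along these.\<close>
      define a where "a = j - \<sigma> - int t"
      have j: "j = \<sigma> + int t + a" and kj: "k - j + int n - int d + int t = M - a"
        and kn: "k - j + int n = int (d - t) + (M - a)"
        using t by (simp_all add: a_def M_def)
      have "(qq powi x) ^ h = (qq ^ h) powi x" for x
        by (simp add: power_int_def power_inverse flip: power_mult) (simp add: mult.commute)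
      moreover have "(qq ^ h) powi (int (d - t) + (M - a)) = (qq ^ h) ^ (d - t) * (qq ^ h) powi (M - a)"
        by (subst power_int_add) simp_all
      ultimately have 1: "(qq powi (k - j + int n)) ^ h = (qq ^ h) ^ (d - t) * (qq ^ h) powi (M - a)"
        unfolding kn by simp
      have 2: "A powi j = A powi \<sigma> * A ^ t * A powi a"
        unfolding j using A0 by (simp add: power_int_add)
      show ?thesis
        unfolding summand_def 1 2 kj a_def[symmetric] creation_coeff_dilate C_def K1_const_mult
        by (simp only: mult_ac)
    qed
    have "(\<Sum>j\<in>J. creation_coeff ?f (M - (j - \<sigma> - int t)) * creation_coeff ?g (j - \<sigma> - int t)) =
        (\<Sum>a\<in>(\<lambda>j. j - \<sigma> - int t) ` J. creation_coeff ?f (M - a) * creation_coeff ?g a)"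
      by (subst sum.reindex) (auto simp: inj_on_def)
    also have "\<dots> = creation_coeff (\<lambda>r. ?f r + ?g r) M"
    proof (rule creation_coeff_convolution)
      show "{0..M} \<subseteq> (\<lambda>j. j - \<sigma> - int t) ` J"
      proof
        fix a assume "a \<in> {0..M}"
        thus "a \<in> (\<lambda>j. j - \<sigma> - int t) ` J"
          using t by (intro image_eqI[of _ _ "a + \<sigma> + int t"]) (auto simp: J_def M_def)
      qed
    qed (simp add: J_def)
    finally show "(\<Sum>j\<in>J. K1_const (coeff (q_deriv_poly n) h * (qq powi (k - j + int n)) ^ h) * summand k j t e) =
        K1_const C * creation_coeff (\<lambda>r. ?f r + ?g r) M"
      unfolding * sum_distrib_left[symmetric] by simp
  qed
  also have "\<dots> = (\<Sum>h\<le>n. \<Sum>e\<in>T. K1_const (coeff (q_deriv_poly n) h * A powi \<sigma> *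
        (\<Sum>t\<le>d. p e t * A ^ t * (qq ^ h) ^ (d - t)) * w e) *
      creation_coeff (\<lambda>r. (qq ^ h) ^ r * fj_coeff r + A ^ r * \<gamma> e r) M)"
    by (simp only: sum_distrib_left sum_distrib_right K1_const_sum)
  finally have main: "op_mult ?x (op_dilate A b) v $$ k = Poly_Mapping.single (int m + 1) \<dots>" .
  have "x_prod i l b v $$ k = scalar (1 / qqfact n) * op_mult ?x (op_dilate A b) v $$ k"
    by (simp add: x_prod_def op_scale_def A_def flip: n)
  also have "\<dots> = Poly_Mapping.single (int m + 1) (\<Sum>h\<le>n. \<Sum>e\<in>T.
      K1_const (step_coeff n \<sigma> d (p e) h * w e) *
      creation_coeff (\<lambda>r. (qq ^ h) ^ r * fj_coeff r + A ^ r * \<gamma> e r) M)"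
    unfolding main scalar_single sum_distrib_left mult.assoc[symmetric] K1_const_mult[symmetric]
    by (simp add: step_coeff_def A_def mult_ac sum_distrib_left)
  finally show ?thesis unfolding A_def M_def .
qed

section \<open>Monomials applied to the vacuum\<close>

definition fock_weight :: "nat \<Rightarrow> nat \<Rightarrow> nat list \<Rightarrow> nat \<Rightarrow> F" where
  "fock_weight i E e r =
     fj_coeff r * (\<Sum>x\<leftarrow>e. (qq ^ x) ^ r) + (if i = 1 then koyama_coeff r * (qq ^ E) ^ r else 0)"

text \<open>Dilating the old product by \<open>qq^n\<close> shifts all its exponents by
  \<open>n\<close>, including the exponent \<open>E\<close> of the Koyama factor, which therefore
  ends up as the sum of all mode orders.\<close>

lemma fock_weight_step:
  "(qq ^ h) ^ r * fj_coeff r + (qq ^ n) ^ r * fock_weight i E e r =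
     fock_weight i (n + E) (h # map ((+) n) e) r"
  by (simp add: fock_weight_def algebra_simps power_add power_mult_distrib o_def
      flip: sum_list_const_mult)

definition contraction_poly :: "nat \<Rightarrow> nat \<Rightarrow> nat list \<Rightarrow> F poly" where
  "contraction_poly i E e =
     (\<Prod>x\<leftarrow>e. [:1, - (qq ^ x):] * [:1, - (qq ^ x / qq):]) * (if i = 1 then [:1, - (qq ^ E):] else 1)"

text \<open>For \<open>m = length e\<close> the bound is the lattice exponent
  \<open>(\<alpha>, m\<alpha> + i\<lambda>)\<close>, as the regularity hypothesis of
  \<open>vertex_operator_nth\<close> requires.\<close>

lemma degree_contraction_poly: "degree (contraction_poly i E e) \<le> 2 * length e + i"
proof (induction e)
  case Nil
  show ?case by (simp add: contraction_poly_def)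
next
  case (Cons x e)
  have "contraction_poly i E (x # e) = [:1, - (qq ^ x):] * [:1, - (qq ^ x / qq):] * contraction_poly i E e"
    by (simp only: contraction_poly_def list.map prod_list.Cons mult.assoc)
  also have "degree \<dots> \<le> degree ([:1, - (qq ^ x):] * [:1, - (qq ^ x / qq):]) + degree (contraction_poly i E e)"
    by (rule degree_mult_le)
  also have "degree ([:1, - (qq ^ x):] * [:1, - (qq ^ x / qq):]) \<le> 1 + 1"
    by (rule order_trans[OF degree_mult_le]) (simp add: add_mono)
  finally show ?case using Cons by simp
qed

definition K1_fps_of_poly :: "F poly \<Rightarrow> K1 fps" where
  "K1_fps_of_poly p = Abs_fps (\<lambda>n. K1_const (coeff p n))"

lemma K1_fps_of_poly_mult: "K1_fps_of_poly (p * q) = K1_fps_of_poly p * K1_fps_of_poly q"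
  by (rule fps_ext)
     (simp add: K1_fps_of_poly_def fps_mult_nth coeff_mult K1_const_sum K1_const_mult atLeast0AtMost)

lemma K1_fps_of_poly_linear: "K1_fps_of_poly [:1, - a:] = 1 - fps_const (K1_const a) * fps_X"
proof (rule fps_ext)
  fix n
  show "K1_fps_of_poly [:1, - a:] $ n = (1 - fps_const (K1_const a) * fps_X) $ n"
    by (cases n) (auto simp: K1_fps_of_poly_def K1_const_uminus coeff_pCons split: nat.split)
qed

lemma K1_fps_of_poly_1 [simp]: "K1_fps_of_poly 1 = 1"
  by (rule fps_ext) (simp add: K1_fps_of_poly_def)

lemma contraction_add:
  "contraction c (\<lambda>r. \<gamma> r + \<delta> r) = contraction c \<gamma> * contraction c \<delta>"
proof -
  have "contraction_log c (\<lambda>r. \<gamma> r + \<delta> r) = contraction_log c \<gamma> + contraction_log c \<delta>"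
    by (rule fps_ext) (simp add: contraction_log_def distrib_left K1_const_diff K1_const_uminus K1_const_add)
  thus ?thesis by (simp add: K1_exp_add)
qed

text \<open>By \<open>fj_fj_level\<close> the logarithm splits into those of
  \<open>1 - qq^x w\<close> and \<open>1 - qq^(x-1) w\<close>.\<close>

lemma contraction_fj:
  "contraction fj_coeff (\<lambda>r. fj_coeff r * (qq ^ x) ^ r) = K1_fps_of_poly ([:1, - (qq ^ x):] * [:1, - (qq ^ x / qq):])"
proof -
  let ?l = "\<lambda>a. Abs_fps (\<lambda>r. K1_const (- (a ^ r / of_nat r)))"
  have "contraction_log fj_coeff (\<lambda>r. fj_coeff r * (qq ^ x) ^ r) = ?l (qq ^ x) + ?l (qq ^ x / qq)"
  proof (rule fps_ext)
    fix r
    show "contraction_log fj_coeff (\<lambda>r. fj_coeff r * (qq ^ x) ^ r) $ r = (?l (qq ^ x) + ?l (qq ^ x / qq)) $ r"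
    proof (cases "r = 0")
      case False
      have "fj_coeff r * heis_level r * (fj_coeff r * (qq ^ x) ^ r) = (1 + inverse qq ^ r) / of_nat r * (qq ^ x) ^ r"
        unfolding mult.assoc[symmetric] using False by (subst fj_fj_level) simp_all
      also have "\<dots> = (qq ^ x) ^ r / of_nat r + (qq ^ x / qq) ^ r / of_nat r"
        by (simp add: divide_inverse power_mult_distrib algebra_simps)
      finally have "- (fj_coeff r * heis_level r * (fj_coeff r * (qq ^ x) ^ r)) =
          - ((qq ^ x) ^ r / of_nat r) + - ((qq ^ x / qq) ^ r / of_nat r)" by (simp only: minus_add_distrib)
      thus ?thesis using False
        by (simp only: contraction_log_def fps_nth_Abs_fps fps_add_nth if_False K1_const_add)
    qed simp
  qed
  thus ?thesis
    by (simp only: K1_exp_add K1_exp_log K1_fps_of_poly_mult K1_fps_of_poly_linear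
        fps_nth_Abs_fps of_nat_0 div_by_0 minus_zero K1_const_0)
qed

lemma contraction_koyama:
  "contraction fj_coeff (\<lambda>r. koyama_coeff r * a ^ r) = K1_fps_of_poly [:1, - a:]"
proof -
  have "contraction_log fj_coeff (\<lambda>r. koyama_coeff r * a ^ r) = Abs_fps (\<lambda>r. K1_const (- (a ^ r / of_nat r)))"
  proof (rule fps_ext)
    fix r
    show "contraction_log fj_coeff (\<lambda>r. koyama_coeff r * a ^ r) $ r = Abs_fps (\<lambda>r. K1_const (- (a ^ r / of_nat r))) $ r"
    proof (cases "r = 0")
      case False
      have "fj_coeff r * heis_level r * (koyama_coeff r * a ^ r) = a ^ r / of_nat r"
        unfolding mult.assoc[symmetric] using False by (subst fj_koyama_level) simp_all
      thus ?thesis using False by (simp only: contraction_log_def fps_nth_Abs_fps if_False)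
    qed simp
  qed
  thus ?thesis by (simp only: K1_exp_log K1_fps_of_poly_linear)
qed

lemma contraction_fock_weight:
  "contraction fj_coeff (fock_weight i E e) $ t = K1_const (coeff (contraction_poly i E e) t)"
proof -
  have "contraction fj_coeff (fock_weight i E e) = K1_fps_of_poly (contraction_poly i E e)"
  proof (induction e)
    case Nil
    have "fock_weight i E [] = (if i = 1 then (\<lambda>r. koyama_coeff r * (qq ^ E) ^ r) else (\<lambda>r. 0))"
      by (simp add: fock_weight_def fun_eq_iff)
    moreover have "contraction_log fj_coeff (\<lambda>r. 0) = 0"
      by (rule fps_ext) (simp add: contraction_log_def)
    ultimately show ?case by (simp add: contraction_poly_def contraction_koyama)
  next
    case (Cons x e)
    have "fock_weight i E (x # e) = (\<lambda>r. fj_coeff r * (qq ^ x) ^ r + fock_weight i E e r)"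
      by (simp add: fock_weight_def fun_eq_iff distrib_left)
    moreover have "contraction_poly i E (x # e) =
        [:1, - (qq ^ x):] * [:1, - (qq ^ x / qq):] * contraction_poly i E e"
      by (simp only: contraction_poly_def list.map prod_list.Cons mult.assoc)
    ultimately show ?case
      by (simp only: contraction_add contraction_fj K1_fps_of_poly_mult Cons)
  qed
  thus ?thesis by (simp add: K1_fps_of_poly_def)
qed

text \<open>
  The lists of mode orders \<open>n\<^sub>j = - l\<^sub>j - 1\<close> below start with the outermost one, \<open>n\<^sub>m\<close>. A step adds
  the exponent \<open>h \<le> n\<close> of the new operator and, since \<open>b(z)\<close> enters as \<open>b(z qq\<^sup>n)\<close>, raises the old
  exponents by \<open>n\<close>.
\<close>

primrec exponents :: "nat list \<Rightarrow> nat list set" where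
  "exponents [] = {[]}"
| "exponents (n # ns) = (\<lambda>(h, e). h # map ((+) n) e) ` ({..n} \<times> exponents ns)"

text \<open>The power of \<open>z\<close> in front of the exponentials: a step multiplies by the
  lattice factor and its \<open>n\<close> derivatives divide by \<open>z^n\<close>.\<close>

primrec z_shift :: "nat \<Rightarrow> nat list \<Rightarrow> int" where
  "z_shift i [] = 0"
| "z_shift i (n # ns) = z_shift i ns + int (2 * length ns + i) - int n"

text \<open>The label of the previous step is recovered by dropping the head and undoing the shift;
  the truncated subtraction is exact on members of \<open>exponents\<close>.\<close>

primrec term_coeff :: "nat \<Rightarrow> nat list \<Rightarrow> nat list \<Rightarrow> F" where
  "term_coeff i [] e = 1"
| "term_coeff i (n # ns) e =
     (let e' = map (\<lambda>x. x - n) (tl e)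
      in step_coeff n (z_shift i ns) (2 * length ns + i) (coeff (contraction_poly i (sum_list ns) e')) (hd e)
         * term_coeff i ns e')"

lemma finite_exponents [simp]: "finite (exponents ns)"
  by (induction ns) auto

lemma length_exponents: "e \<in> exponents ns \<Longrightarrow> length e = length ns"
  by (induction ns arbitrary: e) auto

lemma inj_exponents_step: "inj_on (\<lambda>(h, e). h # map ((+) n) e) A" for n :: nat
  by (auto simp: inj_on_def dest: map_injective[OF _ inj_on_add])

text \<open>The vector \<open>1\<close> times \<open>e^0\<close> of the space on which both
  \<open>a_op 0\<close> and \<open>a_op 1\<close> act, so one test vector serves both cases.\<close>

definition vacuum :: L where
  "vacuum = Poly_Mapping.single 0 1"

lemma a_op_vacuum_nth:
  assumes "i = 0 \<or> i = 1"
  shows "a_op i vacuum $$ j = Poly_Mapping.single 0 (creation_coeff (fock_weight i 0 []) j)"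
proof (cases "i = 1")
  case True
  hence "fock_weight i 0 [] = koyama_coeff" by (simp add: fock_weight_def fun_eq_iff)
  thus ?thesis using True koyama_vacuum_nth[of j] by (simp add: a_op_def vacuum_def)
next
  case False
  hence "fock_weight i 0 [] = (\<lambda>_. 0)" by (simp add: fock_weight_def fun_eq_iff)
  thus ?thesis using False assms
    by (simp add: a_op_def vacuum_def creation_coeff_def creation_exp_0)
qed

definition mode_orders :: "int list \<Rightarrow> nat list" where
  "mode_orders ls = map (\<lambda>l. nat (- l - 1)) (rev ls)"

lemma mode_orders_simps [simp]:
  "mode_orders [] = []" "mode_orders (ls @ [l]) = nat (- l - 1) # mode_orders ls"
  "length (mode_orders ls) = length ls"
  by (simp_all add: mode_orders_def)

text \<open>Each outer product is one application of \<open>x_prod_nth\<close>. Its degree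
  hypothesis holds because a label has one entry for each factor \<open>x(z)\<close>.\<close>

lemma x_monomial_vacuum_nth:
  assumes "i = 0 \<or> i = 1"
  shows "x_monomial i ls vacuum $$ j = Poly_Mapping.single (int (length ls))
    (creation_comb (exponents (mode_orders ls)) (\<lambda>e. K1_const (term_coeff i (mode_orders ls) e))
      (fock_weight i (sum_list (mode_orders ls))) (j - z_shift i (mode_orders ls)))"
proof (induction ls arbitrary: j rule: rev_induct)
  case Nil
  show ?case
    by (simp add: x_monomial_def a_op_vacuum_nth[OF assms] creation_comb_def)
next
  case (snoc l ls)
  define ns where "ns = mode_orders ls"
  define n where "n = nat (- l - 1)"
  define d where "d = 2 * length ls + i"
  let ?p = "\<lambda>e. coeff (contraction_poly i (sum_list ns) e)"
  have len: "length ns = length ls" by (simp add: ns_def)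
  have "x_monomial i (ls @ [l]) vacuum $$ j = x_prod i l (x_monomial i ls) vacuum $$ j"
    by (simp add: x_monomial_def)
  also have "\<dots> = Poly_Mapping.single (int (length ls) + 1)
    (\<Sum>h\<le>n. \<Sum>e\<in>exponents ns. K1_const (step_coeff n (z_shift i ns) d (?p e) h * term_coeff i ns e) *
      creation_coeff (\<lambda>r. (qq ^ h) ^ r * fj_coeff r + (qq ^ n) ^ r * fock_weight i (sum_list ns) e r)
        (j - (z_shift i ns + int d - int n)))"
  proof (rule x_prod_nth)
    show "?p e t = 0" if "e \<in> exponents ns" "t > d" for e t
      using degree_contraction_poly[of i "sum_list ns" e] length_exponents[OF that(1)] that(2) len
      by (intro coeff_eq_0) (simp add: d_def)
  qed (simp_all add: d_def n_def snoc.IH ns_def contraction_fock_weight)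
  also have "(\<Sum>h\<le>n. \<Sum>e\<in>exponents ns. K1_const (step_coeff n (z_shift i ns) d (?p e) h * term_coeff i ns e) *
      creation_coeff (\<lambda>r. (qq ^ h) ^ r * fj_coeff r + (qq ^ n) ^ r * fock_weight i (sum_list ns) e r)
        (j - (z_shift i ns + int d - int n)))
    = (\<Sum>(h, e)\<in>{..n} \<times> exponents ns. K1_const (term_coeff i (n # ns) (h # map ((+) n) e)) *
        creation_coeff (fock_weight i (sum_list (n # ns)) (h # map ((+) n) e)) (j - z_shift i (n # ns)))"
    unfolding sum.cartesian_product fock_weight_step
    by (intro sum.cong) (auto simp: d_def len o_def)
  also have "\<dots> = creation_comb (exponents (n # ns)) (\<lambda>e. K1_const (term_coeff i (n # ns) e))
      (fock_weight i (sum_list (n # ns))) (j - z_shift i (n # ns))"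
    unfolding creation_comb_def exponents.simps
    by (subst sum.reindex[OF inj_exponents_step]) (auto intro!: sum.cong)
  finally show ?case by (simp add: ns_def n_def add.commute)
qed

section \<open>The label with \<open>h = 0\<close> in every step\<close>

primrec lead_exponent :: "nat list \<Rightarrow> nat list" where
  "lead_exponent [] = []"
| "lead_exponent (n # ns) = 0 # map ((+) n) (lead_exponent ns)"

lemma length_lead_exponent [simp]: "length (lead_exponent ns) = length ns"
  by (induction ns) auto

lemma lead_exponent_in: "lead_exponent ns \<in> exponents ns"
  by (induction ns) force+

lemma sum_list_map_add: "sum_list (map ((+) n) e) = length e * n + sum_list e" for n :: nat
  by (induction e) auto

text \<open>The shifts by \<open>n\<close> add the same total to every label, so the sum is least
  exactly when every \<open>h\<close> is 0.\<close>

lemma sum_lead_exponent_le: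
  "e \<in> exponents ns \<Longrightarrow> sum_list (lead_exponent ns) \<le> sum_list e \<and>
     (sum_list (lead_exponent ns) = sum_list e \<longrightarrow> e = lead_exponent ns)"
proof (induction ns arbitrary: e)
  case (Cons n ns)
  then obtain h e' where e: "e = h # map ((+) n) e'" "e' \<in> exponents ns" by auto
  have "length e' = length ns" using e(2) by (rule length_exponents)
  thus ?case using Cons.IH[OF e(2)] by (auto simp: e(1) sum_list_map_add)
qed simp

lemma sorted_lead_exponent: "sorted (lead_exponent ns)"
  by (induction ns) (auto simp: sorted_map intro: sorted_wrt_mono_rel[rotated])

text \<open>The entries are the partial sums of the mode orders, starting from 0, without the last
  one. Their differences give every order but the innermost, which the total sum supplies.\<close>

lemma lead_exponent_inj:
  "lead_exponent ns = lead_exponent ns' \<Longrightarrow> sum_list ns = sum_list ns' \<Longrightarrow> ns = ns'"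
proof (induction ns arbitrary: ns')
  case Nil
  thus ?case by (cases ns') auto
next
  case (Cons n ns)
  then obtain n' rest where ns': "ns' = n' # rest" by (cases ns') auto
  have eq: "map ((+) n) (lead_exponent ns) = map ((+) n') (lead_exponent rest)"
    using Cons.prems ns' by simp
  have nn: "n = n'"
  proof (cases ns)
    case Nil
    hence "rest = []" using eq by (metis length_0_conv length_lead_exponent length_map)
    thus ?thesis using Cons.prems Nil ns' by simp
  next
    case (Cons a as)
    hence "rest \<noteq> []" using eq by auto
    then obtain b bs where "rest = b # bs" by (cases rest) auto
    thus ?thesis using eq Cons by simp
  qed
  hence "lead_exponent ns = lead_exponent rest"
    using eq by (auto dest: map_injective[OF _ inj_on_add])
  moreover have "sum_list ns = sum_list rest" using Cons.prems ns' nn by simp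
  ultimately show ?case using Cons.IH ns' nn by blast
qed

text \<open>The lattice exponents \<open>2 j + i\<close> for \<open>j < m\<close> add up to
  \<open>m (m - 1) + i m\<close>. Hence the length and \<open>z_shift\<close> determine the sum of
  the mode orders.\<close>

lemma z_shift_eq:
  "z_shift i ns = int (length ns) * (int (length ns) - 1) + int i * int (length ns) - int (sum_list ns)"
  by (induction ns) (auto simp: algebra_simps)

text \<open>The bounds \<open>- 1 - i\<close> and \<open>- 3\<close> rewritten for
  \<open>n = - l - 1\<close>; the innermost order comes last, whence the case
  \<open>ns = []\<close>.\<close>

primrec admissible_orders :: "nat \<Rightarrow> nat list \<Rightarrow> bool" where
  "admissible_orders i [] \<longleftrightarrow> True"
| "admissible_orders i (n # ns) \<longleftrightarrow> n \<ge> (if ns = [] then i else 2) \<and> admissible_orders i ns"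

lemma poly_prod_list_map: "poly (\<Prod>x\<leftarrow>xs. f x) y = (\<Prod>x\<leftarrow>xs. poly (f x) y)"
  by (induction xs) simp_all

text \<open>At \<open>h = 0\<close> the step coefficient is a unit times the contraction polynomial
  at \<open>qq^n\<close>. The roots are \<open>qq^(-x)\<close> and \<open>qq^(1-x)\<close>, and
  \<open>qq^(-E)\<close> if \<open>i = 1\<close>; the bounds on \<open>n\<close> avoid them
  all.\<close>

lemma term_coeff_lead_nonzero:
  assumes "i = 0 \<or> i = 1" "admissible_orders i ns"
  shows "term_coeff i ns (lead_exponent ns) \<noteq> 0"
  using assms(2)
proof (induction ns)
  case (Cons n ns)
  define d where "d = 2 * length ns + i"
  let ?p = "contraction_poly i (sum_list ns) (lead_exponent ns)"
  have n: "n \<ge> (if ns = [] then i else 2)" and "admissible_orders i ns" using Cons.prems by auto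
  hence IH: "term_coeff i ns (lead_exponent ns) \<noteq> 0" using Cons.IH by blast
  have "(\<Sum>t\<le>d. coeff ?p t * (qq ^ n) ^ t) = poly ?p (qq ^ n)"
    unfolding poly_altdef using degree_contraction_poly[of i "sum_list ns" "lead_exponent ns"]
    by (intro sum.mono_neutral_right) (auto simp: coeff_eq_0 d_def)
  moreover have "poly ?p (qq ^ n) \<noteq> 0"
  proof -
    have factors: "1 - qq ^ n * qq ^ x \<noteq> 0 \<and> 1 - qq ^ n * (qq ^ x / qq) \<noteq> 0" if "ns \<noteq> []" for x
    proof -
      have "n \<ge> 2" using n that by simp
      hence "qq ^ n = qq * qq ^ (n - 1)" by (simp flip: power_Suc)
      hence "qq ^ n * (qq ^ x / qq) = qq ^ (n - 1 + x)" by (simp add: power_add)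
      thus ?thesis using \<open>n \<ge> 2\<close> by (simp flip: power_add)
    qed
    have "poly ([:1, - (qq ^ x):] * [:1, - (qq ^ x / qq):]) (qq ^ n) \<noteq> 0" if "ns \<noteq> []" for x
    proof -
      have "poly [:1, - a:] y = 1 - y * a" for a y :: F by simp
      thus ?thesis using factors[OF that, of x] unfolding poly_mult by (simp only: mult_eq_0_iff) blast
    qed
    moreover have "lead_exponent ns = []" if "ns = []" using that by simp
    ultimately have "(\<Prod>x\<leftarrow>lead_exponent ns. poly ([:1, - (qq ^ x):] * [:1, - (qq ^ x / qq):]) (qq ^ n)) \<noteq> 0"
      by (cases "ns = []") (auto simp: prod_list_zero_iff simp del: poly_mult poly_pCons)
    \<comment> \<open>If \<open>i = 1\<close>, then \<open>n\<close> is positive at every step, so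
      \<open>n + sum_list ns\<close> is not 0.\<close>
    moreover have "poly (if i = 1 then [:1, - (qq ^ sum_list ns):] else 1) (qq ^ n) \<noteq> 0"
      using n assms(1) by (auto simp flip: power_add split: if_splits)
    ultimately show ?thesis
      unfolding contraction_poly_def poly_mult[of "prod_list _"] poly_prod_list_map
      by (simp only: mult_eq_0_iff) blast
  qed
  ultimately have "step_coeff n (z_shift i ns) d (coeff ?p) 0 \<noteq> 0"
    by (simp add: step_coeff_def coeff_q_deriv_poly_0)
  thus ?case using IH by (simp add: d_def o_def Let_def)
qed simp

section \<open>Linear independence\<close>

lemma lookup_heis_var_mult:
  assumes "r \<ge> 1"
  shows "Poly_Mapping.lookup (heis_var r * f) (Poly_Mapping.single 0 k) =
    (if r = 1 \<and> k > 0 then Poly_Mapping.lookup f (Poly_Mapping.single 0 (k - 1)) else 0)"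
proof (induction f rule: poly_mapping_single_add_induct)
  case (single s d)
  have *: "Poly_Mapping.single (r - 1) 1 + s = Poly_Mapping.single 0 k \<longleftrightarrow>
      r = 1 \<and> k > 0 \<and> s = Poly_Mapping.single 0 (k - 1)"
  proof
    assume eq: "Poly_Mapping.single (r - 1) 1 + s = Poly_Mapping.single 0 k"
    have eq': "(1 when r - 1 = j) + Poly_Mapping.lookup s j = (k when 0 = j)" for j
      using arg_cong[OF eq, of "\<lambda>m. Poly_Mapping.lookup m j"] by (simp add: lookup_add lookup_single)
    have "r = 1" using eq'[of "r - 1"] assms by (auto simp: when_def split: if_splits)
    moreover have "k > 0" using eq'[of 0] calculation by (auto simp: when_def)
    moreover have "s = Poly_Mapping.single 0 (k - 1)"
    proof (rule poly_mapping_eqI)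
      fix j
      show "Poly_Mapping.lookup s j = Poly_Mapping.lookup (Poly_Mapping.single 0 (k - 1)) j"
        using eq'[of j] \<open>r = 1\<close> by (auto simp: when_def lookup_single split: if_splits)
    qed
    ultimately show "r = 1 \<and> k > 0 \<and> s = Poly_Mapping.single 0 (k - 1)" by blast
  qed (simp flip: single_add)
  have "heis_var r * Poly_Mapping.single s d = Poly_Mapping.single (Poly_Mapping.single (r - 1) 1 + s) d"
    by (simp add: heis_var_def mult_single)
  thus ?case by (auto simp: lookup_single when_def * simp del: One_nat_def)
qed (simp add: distrib_left lookup_add)

text \<open>The monomial \<open>single 0 k\<close> is the \<open>k\<close>-th power of
  \<open>a(-1)\<close>, which only the term \<open>r = 1\<close> of the exponent produces. Each
  \<open>a(-1)\<close> carries one \<open>z\<close>, so \<open>n\<close>, \<open>j\<close> and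
  \<open>k\<close> must agree.\<close>

lemma lookup_creation_power:
  "Poly_Mapping.lookup ((K1_creation \<gamma> ^ j) $ n) (Poly_Mapping.single 0 k) =
     (if n = k \<and> j = k then \<gamma> 1 ^ k else 0)"
proof (induction j arbitrary: n k)
  case 0
  have "Poly_Mapping.single (0::nat) k = 0 \<longleftrightarrow> k = 0"
    by (metis lookup_single_eq lookup_zero single_zero)
  thus ?case by (auto simp: lookup_one when_def)
next
  case (Suc j)
  have "(K1_creation \<gamma> ^ Suc j) $ n = (\<Sum>r=1..n. K1_creation \<gamma> $ r * (K1_creation \<gamma> ^ j) $ (n - r))"
    by (subst sum_atLeast1_eq) (simp_all add: fps_mult_nth)
  hence "Poly_Mapping.lookup ((K1_creation \<gamma> ^ Suc j) $ n) (Poly_Mapping.single 0 k) =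
      (\<Sum>r=1..n. Poly_Mapping.lookup (K1_creation \<gamma> $ r * (K1_creation \<gamma> ^ j) $ (n - r)) (Poly_Mapping.single 0 k))"
    by (simp only: lookup_sum)
  also have "\<dots> = (\<Sum>r=1..n. if r = 1 then (if n = k \<and> Suc j = k then \<gamma> 1 ^ k else 0) else 0)"
  proof (intro sum.cong refl)
    fix r assume r: "r \<in> {1..n}"
    have "K1_creation \<gamma> $ r * (K1_creation \<gamma> ^ j) $ (n - r) =
        K1_const (\<gamma> r) * (heis_var r * (K1_creation \<gamma> ^ j) $ (n - r))"
      using r by (simp add: K1_creation_def mult.assoc)
    hence "Poly_Mapping.lookup (K1_creation \<gamma> $ r * (K1_creation \<gamma> ^ j) $ (n - r)) (Poly_Mapping.single 0 k) =
        \<gamma> r * (if r = 1 \<and> k > 0 then if n - r = k - 1 \<and> j = k - 1 then \<gamma> 1 ^ (k - 1) else 0 else 0)"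
      using r by (simp only: lookup_K1_const_mult) (subst lookup_heis_var_mult, simp, simp only: Suc)
    also have "\<dots> = (if r = 1 then (if n = k \<and> Suc j = k then \<gamma> 1 ^ k else 0) else 0)"
      using r by (cases k) auto
    finally show "Poly_Mapping.lookup (K1_creation \<gamma> $ r * (K1_creation \<gamma> ^ j) $ (n - r)) (Poly_Mapping.single 0 k) = \<dots>" .
  qed
  also have "\<dots> = (if n = k \<and> Suc j = k then \<gamma> 1 ^ k else 0)"
    by (cases "n = 0") (auto simp: sum.delta)
  finally show ?case .
qed

lemma lookup_creation_coeff:
  "Poly_Mapping.lookup (creation_coeff \<gamma> K) (Poly_Mapping.single 0 k) =
     (if K = int k then \<gamma> 1 ^ k / of_nat (fact k) else 0)"
proof (cases "K \<ge> 0")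
  case True
  have "Poly_Mapping.lookup (creation_coeff \<gamma> K) (Poly_Mapping.single 0 k) =
      (\<Sum>j\<le>nat K. 1 / of_nat (fact j) * (if nat K = k \<and> j = k then \<gamma> 1 ^ k else 0))"
    using True by (simp only: creation_coeff_def if_True K1_exp_def fps_nth_Abs_fps lookup_sum
        lookup_K1_const_mult lookup_creation_power)
  also have "\<dots> = (\<Sum>j\<le>nat K. if j = k then (if nat K = k then \<gamma> 1 ^ k / of_nat (fact k) else 0) else 0)"
    by (intro sum.cong) auto
  also have "\<dots> = (if K = int k then \<gamma> 1 ^ k / of_nat (fact k) else 0)"
    using True by auto
  finally show ?thesis .
qed auto

lemma sum_list_sqrt_q_power:
  assumes "finite A" "set e \<subseteq> A"
  shows "(\<Sum>x\<leftarrow>e. sqrt_q ^ x) = (\<Sum>n\<in>A. of_nat (count_list e n) * sqrt_q ^ n)"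
  using assms(2)
proof (induction e)
  case (Cons x e)
  have "(\<Sum>n\<in>A. of_nat (count_list (x # e) n) * sqrt_q ^ n) =
      (\<Sum>n\<in>A. (if n = x then sqrt_q ^ n else 0) + of_nat (count_list e n) * sqrt_q ^ n)"
    by (intro sum.cong) (auto simp: distrib_right)
  also have "\<dots> = sqrt_q ^ x + (\<Sum>x\<leftarrow>e. sqrt_q ^ x)"
    using Cons assms(1) by (simp add: sum.distrib)
  finally show ?case by simp
qed simp

text \<open>As \<open>qq = sqrt_q ^ 4\<close>, the sums run over powers
  \<open>sqrt_q ^ (4 x)\<close>, whose multiplicities can be compared; multiplication by 4 is
  injective.\<close>

lemma mset_eq_of_qq_power_sum:
  assumes "(\<Sum>x\<leftarrow>e. qq ^ x) = (\<Sum>x\<leftarrow>e'. qq ^ x)"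
  shows "mset e = mset e'"
proof -
  let ?m = "map ((*) (4::nat))"
  let ?A = "set (?m e) \<union> set (?m e')"
  have "(\<Sum>x\<leftarrow>?m f. sqrt_q ^ x) = (\<Sum>x\<leftarrow>f. qq ^ x)" for f
    by (simp add: qq_eq_sqrt_q o_def power_mult)
  hence "(\<Sum>n\<in>?A. of_nat (count_list (?m e) n) * sqrt_q ^ n) = (\<Sum>n\<in>?A. of_nat (count_list (?m e') n) * sqrt_q ^ n)"
    using assms sum_list_sqrt_q_power[of ?A "?m e"] sum_list_sqrt_q_power[of ?A "?m e'"] by simp
  hence "count_list (?m e) n = count_list (?m e') n" if "n \<in> ?A" for n
    using sum_sqrt_q_power_eqD[of ?A] that by blast
  moreover have "count_list (?m e) n = count_list (?m e') n" if "n \<notin> ?A" for n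
    using that by (metis Un_iff count_list_0_iff)
  ultimately have "mset (?m e) = mset (?m e')"
    by (intro multiset_eqI) (metis count_mset)
  hence "image_mset ((*) 4) (mset e) = image_mset ((*) 4) (mset e')" by simp
  thus ?thesis by (rule multiset.inj_map_strong[rotated]) simp
qed

lemma fock_weight_1_inj:
  assumes "fock_weight i E e 1 = fock_weight i E e' 1"
  shows "mset e = mset e'"
  using assms fj_coeff_nonzero[of 1]
  by (intro mset_eq_of_qq_power_sum) (simp add: fock_weight_def)

text \<open>The hypothesis extends from powers of \<open>g x\<close> to every polynomial in
  \<open>g x\<close>; a polynomial vanishing at all values of \<open>g\<close> except
  \<open>y\<close> isolates the fibre.\<close>

lemma power_sums_zero_imp_fibre_sum_zero:
  fixes c g :: "'a \<Rightarrow> 'b::field"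
  assumes "finite I" and "\<And>k. (\<Sum>x\<in>I. c x * g x ^ k) = 0"
  shows "(\<Sum>x\<in>{x\<in>I. g x = y}. c x) = 0"
proof -
  let ?Y = "g ` I - {y}"
  define P where "P = (\<Prod>y'\<in>?Y. [:- y', 1:])"
  have "(\<Sum>x\<in>I. c x * poly P (g x)) = (\<Sum>k\<le>degree P. coeff P k * (\<Sum>x\<in>I. c x * g x ^ k))"
    unfolding poly_altdef sum_distrib_left by (subst sum.swap) (simp add: mult_ac)
  hence "(\<Sum>x\<in>I. c x * poly P (g x)) = 0" by (simp add: assms(2))
  moreover have "(\<Sum>x\<in>I. c x * poly P (g x)) = (\<Sum>x\<in>{x\<in>I. g x = y}. c x * poly P (g x))"
    using assms(1) by (intro sum.mono_neutral_right) (auto simp: P_def poly_prod)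
  moreover have "\<dots> = (\<Sum>x\<in>{x\<in>I. g x = y}. c x) * poly P y"
    by (simp add: sum_distrib_right)
  moreover have "poly P y \<noteq> 0"
    using assms(1) by (auto simp: P_def poly_prod)
  ultimately show ?thesis by simp
qed

section \<open>Basis indices in terms of mode orders\<close>

lemma basis_index_snoc:
  "basis_index i (ls @ [l]) \<longleftrightarrow> basis_index i ls \<and> l \<le> (if ls = [] then - 1 - int i else - 3)"
  unfolding basis_index_def by (auto simp: nth_append less_Suc_eq split: if_splits)

lemma admissible_orders_mode_orders: "basis_index i ls \<Longrightarrow> admissible_orders i (mode_orders ls)"
proof (induction ls rule: rev_induct)
  case (snoc l ls)
  have "mode_orders ls = [] \<longleftrightarrow> ls = []" by (simp add: mode_orders_def)
  thus ?case using snoc by (auto simp: basis_index_snoc split: if_splits)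
qed simp

text \<open>The truncation by \<open>nat\<close> loses information only for \<open>l > - 1\<close>,
  which the basis conditions exclude.\<close>

lemma mode_orders_inj:
  "basis_index i ls \<Longrightarrow> basis_index i ls' \<Longrightarrow> mode_orders ls = mode_orders ls' \<Longrightarrow> ls = ls'"
proof (induction ls arbitrary: ls' rule: rev_induct)
  case Nil
  thus ?case by (simp add: mode_orders_def)
next
  case (snoc l ls)
  then obtain l' rest where ls': "ls' = rest @ [l']"
    by (cases ls' rule: rev_cases) (auto simp: mode_orders_def)
  have "l \<le> -1" "l' \<le> -1" using snoc.prems ls' by (auto simp: basis_index_snoc split: if_splits)
  thus ?case using snoc ls' by (auto simp: basis_index_snoc)
qed

text \<open>An exponential has \<open>a(-1)^k\<close> only at \<open>z^k\<close>. Reading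
  \<open>z^(\<sigma> + k)\<close> therefore isolates the monomials with \<open>z_shift\<close> equal
  to \<open>\<sigma>\<close>, and the lattice index isolates the length.\<close>

lemma x_monomial_lookup:
  assumes "i = 0 \<or> i = 1"
  shows "Poly_Mapping.lookup (Poly_Mapping.lookup (x_monomial i ls vacuum $$ (\<sigma> + int k)) (int m)) (Poly_Mapping.single 0 k) =
    (if length ls = m \<and> z_shift i (mode_orders ls) = \<sigma>
     then (\<Sum>e\<in>exponents (mode_orders ls). term_coeff i (mode_orders ls) e *
       fock_weight i (sum_list (mode_orders ls)) e 1 ^ k) / of_nat (fact k) else 0)"
proof -
  have "Poly_Mapping.lookup (Poly_Mapping.lookup (x_monomial i ls vacuum $$ (\<sigma> + int k)) (int m)) (Poly_Mapping.single 0 k) =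
     (if length ls = m then \<Sum>e\<in>exponents (mode_orders ls). term_coeff i (mode_orders ls) e *
       (if \<sigma> + int k - z_shift i (mode_orders ls) = int k
        then fock_weight i (sum_list (mode_orders ls)) e 1 ^ k / of_nat (fact k) else 0) else 0)"
    unfolding x_monomial_vacuum_nth[OF assms] creation_comb_def lookup_single when_def
    by (simp add: lookup_sum lookup_K1_const_mult lookup_creation_coeff del: One_nat_def)
  thus ?thesis by (auto simp: sum_divide_distrib)
qed

lemma x_monomial_independent:
  assumes i: "i = 0 \<or> i = 1" and L: "finite L" "\<And>ls. ls \<in> L \<Longrightarrow> basis_index i ls"
    and zero: "(\<Sum>ls\<in>L. op_scale (\<kappa> ls) (x_monomial i ls)) = 0" and "ls \<in> L"
  shows "\<kappa> ls = 0"
proof (rule ccontr)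
  let ?N = mode_orders
  define S where "S = (\<lambda>ls. sum_list (lead_exponent (?N ls)))"
  assume "\<kappa> ls \<noteq> 0"
  \<comment> \<open>Among the monomials with nonzero coefficient, one is chosen whose leading label
    has the least sum.\<close>
  hence "\<exists>ls0. (ls0 \<in> L \<and> \<kappa> ls0 \<noteq> 0) \<and> (\<forall>ls'. ls' \<in> L \<and> \<kappa> ls' \<noteq> 0 \<longrightarrow> S ls0 \<le> S ls')"
    using \<open>ls \<in> L\<close> by (intro ex_has_least_nat[of _ ls]) blast
  then obtain ls0 where ls0: "ls0 \<in> L" "\<kappa> ls0 \<noteq> 0"
    and min: "\<And>ls'. ls' \<in> L \<Longrightarrow> \<kappa> ls' \<noteq> 0 \<Longrightarrow> S ls0 \<le> S ls'" by blast
  define \<sigma> where "\<sigma> = z_shift i (?N ls0)"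
  define E where "E = sum_list (?N ls0)"
  define e0 where "e0 = lead_exponent (?N ls0)"
  \<comment> \<open>By \<open>z_shift_eq\<close> the mode orders of these monomials have the common
    sum \<open>E\<close>, so their weights share the Koyama summand and can be compared.\<close>
  define L1 where "L1 = {ls \<in> L. length ls = length ls0 \<and> z_shift i (?N ls) = \<sigma>}"
  have E: "sum_list (?N ls) = E" if "ls \<in> L1" for ls
    using that z_shift_eq[of i "?N ls"] z_shift_eq[of i "?N ls0"] by (auto simp: L1_def \<sigma>_def E_def)
  let ?I = "Sigma L1 (\<lambda>ls. exponents (?N ls))"
  let ?c = "\<lambda>(ls, e). \<kappa> ls * term_coeff i (?N ls) e" and ?g = "\<lambda>(ls, e). fock_weight i E e 1"
  have finL1: "finite L1" using L(1) by (simp add: L1_def)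
  hence fin: "finite ?I" by simp
  have "(\<Sum>x\<in>?I. ?c x * ?g x ^ k) = 0" for k
  proof -
    let ?f = "\<lambda>v::L. Poly_Mapping.lookup (Poly_Mapping.lookup v (int (length ls0))) (Poly_Mapping.single 0 k)"
    have lin: "?f (scalar a * v) = a * ?f v" for a v
    proof (induction v rule: poly_mapping_single_add_induct)
      case (single m f)
      show ?case by (simp add: scalar_single lookup_single when_def lookup_K1_const_mult)
    qed (simp add: distrib_left lookup_add)
    have "?f ((\<Sum>ls\<in>L. op_scale (\<kappa> ls) (x_monomial i ls)) vacuum $$ (\<sigma> + int k)) =
        (\<Sum>ls\<in>L. \<kappa> ls * ?f (x_monomial i ls vacuum $$ (\<sigma> + int k)))"
      using L(1)
    proof (induction L rule: finite_induct)
      case (insert ls L)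
      thus ?case by (simp add: op_scale_def lookup_add lin)
    qed simp
    hence "0 = (\<Sum>ls\<in>L. \<kappa> ls * ?f (x_monomial i ls vacuum $$ (\<sigma> + int k)))"
      unfolding zero by simp
    also have "\<dots> = (\<Sum>ls\<in>L1. \<kappa> ls * ?f (x_monomial i ls vacuum $$ (\<sigma> + int k)))"
      using L(1) unfolding L1_def
      by (intro sum.mono_neutral_right) (auto simp: x_monomial_lookup[OF i])
    also have "\<dots> = (\<Sum>ls\<in>L1. (\<Sum>e\<in>exponents (?N ls). ?c (ls, e) * ?g (ls, e) ^ k) / of_nat (fact k))"
    proof (rule sum.cong)
      fix ls assume ls: "ls \<in> L1"
      show "\<kappa> ls * ?f (x_monomial i ls vacuum $$ (\<sigma> + int k)) =
          (\<Sum>e\<in>exponents (?N ls). ?c (ls, e) * ?g (ls, e) ^ k) / of_nat (fact k)"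
        using ls by (simp add: x_monomial_lookup[OF i] E[OF ls] L1_def sum_distrib_left mult.assoc)
    qed simp
    also have "\<dots> = (\<Sum>x\<in>?I. ?c x * ?g x ^ k) / of_nat (fact k)"
      using finL1 unfolding sum_divide_distrib[symmetric] by (subst sum.Sigma) (auto intro!: sum.cong)
    finally show ?thesis by simp
  qed
  \<comment> \<open>The fibre taken is that of the leading label of \<open>ls0\<close>; all its
    other members turn out to have coefficient zero.\<close>
  from power_sums_zero_imp_fibre_sum_zero[OF fin this]
  have "(\<Sum>x\<in>{x\<in>?I. ?g x = fock_weight i E e0 1}. ?c x) = 0" by blast
  moreover have "(\<Sum>x\<in>{x\<in>?I. ?g x = fock_weight i E e0 1}. ?c x) = (\<Sum>x\<in>{(ls0, e0)}. ?c x)"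
  proof (rule sum.mono_neutral_right)
    show "finite {x\<in>?I. ?g x = fock_weight i E e0 1}" using fin by simp
    show "{(ls0, e0)} \<subseteq> {x\<in>?I. ?g x = fock_weight i E e0 1}"
      using ls0(1) lead_exponent_in[of "?N ls0"] by (auto simp: L1_def \<sigma>_def e0_def)
    show "\<forall>x\<in>{x\<in>?I. ?g x = fock_weight i E e0 1} - {(ls0, e0)}. ?c x = 0"
    proof
      fix x assume x: "x \<in> {x\<in>?I. ?g x = fock_weight i E e0 1} - {(ls0, e0)}"
      obtain ls e where [simp]: "x = (ls, e)" by (cases x)
      have ls: "ls \<in> L1" "e \<in> exponents (?N ls)" and ne: "(ls, e) \<noteq> (ls0, e0)"
        and ms: "mset e = mset e0"
        using x by (auto intro: fock_weight_1_inj)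
      have "\<kappa> ls = 0"
      proof (rule ccontr)
        assume "\<kappa> ls \<noteq> 0"
        \<comment> \<open>Equal multisets have equal sums, so
          \<open>S ls0 \<le> S ls \<le> sum_list e = S ls0\<close>, and \<open>e\<close> is itself a
          leading label.\<close>
        hence "S ls0 \<le> S ls" using ls(1) min by (auto simp: L1_def)
        moreover have "S ls \<le> sum_list e" "S ls = sum_list e \<Longrightarrow> e = lead_exponent (?N ls)"
          using sum_lead_exponent_le[OF ls(2)] by (auto simp: S_def)
        moreover have "sum_list e = S ls0"
          using ms by (metis S_def e0_def sum_mset_sum_list)
        ultimately have e: "e = lead_exponent (?N ls)" by simp
        \<comment> \<open>Both leading labels are sorted, so equal multisets mean equal
          lists.\<close>
        have "e = e0"
          using properties_for_sort[OF ms] properties_for_sort[OF refl, of e0]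
            sorted_lead_exponent[of "?N ls"] sorted_lead_exponent[of "?N ls0"]
          unfolding e e0_def by simp
        hence "?N ls = ?N ls0"
          using E[OF ls(1)] e lead_exponent_inj[of "?N ls" "?N ls0"] by (simp add: e0_def E_def)
        hence "ls = ls0"
          using mode_orders_inj L(2) ls(1) ls0(1) by (auto simp: L1_def)
        thus False using ne \<open>e = e0\<close> by simp
      qed
      thus "?c x = 0" by simp
    qed
  qed
  ultimately have "\<kappa> ls0 * term_coeff i (?N ls0) e0 = 0" by simp
  moreover have "term_coeff i (?N ls0) e0 \<noteq> 0"
    unfolding e0_def using i L(2)[OF ls0(1)] by (intro term_coeff_lead_nonzero admissible_orders_mode_orders)
  ultimately show False using ls0(2) by simp
qed

section \<open>Counting basis elements by degree\<close>

text \<open>For entries \<open>d1, ..., dm\<close> this is \<open>d1 + 2 d2 + ... + m dm\<close>,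
  the size of the partition with \<open>dk\<close> parts equal to \<open>k\<close>.\<close>

primrec weighted_sum :: "nat list \<Rightarrow> nat" where
  "weighted_sum [] = 0"
| "weighted_sum (d # ds) = sum_list (d # ds) + weighted_sum ds"

lemma weighted_sum_snoc: "weighted_sum (ds @ [d]) = weighted_sum ds + Suc (length ds) * d"
  by (induction ds) auto

lemma sum_list_le_weighted_sum: "sum_list ds \<le> weighted_sum ds"
  by (induction ds) auto

definition weighted_lists :: "nat \<Rightarrow> nat \<Rightarrow> nat list set" where
  "weighted_lists m N = {ds. length ds = m \<and> weighted_sum ds = N}"

lemma finite_weighted_lists [simp]: "finite (weighted_lists m N)"
proof (rule finite_subset)
  show "weighted_lists m N \<subseteq> {ds. set ds \<subseteq> {..N} \<and> length ds = m}"
  proof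
    fix ds assume "ds \<in> weighted_lists m N"
    hence ds: "length ds = m" "weighted_sum ds = N" by (auto simp: weighted_lists_def)
    have "x \<le> N" if "x \<in> set ds" for x
      using member_le_sum_list[OF that] sum_list_le_weighted_sum[of ds] ds(2) by simp
    thus "ds \<in> {ds. set ds \<subseteq> {..N} \<and> length ds = m}" using ds by auto
  qed
qed (rule finite_lists_length_eq, simp)

text \<open>Either there is no part \<open>m + 1\<close>, and the last entry 0 is dropped, or one
  such part is removed.\<close>

lemma card_weighted_lists_Suc:
  "card (weighted_lists (Suc m) N) = card (weighted_lists m N) +
     (if N < Suc m then 0 else card (weighted_lists (Suc m) (N - Suc m)))"
proof -
  let ?z = "\<lambda>ds. ds @ [0::nat]" and ?s = "\<lambda>ds. butlast ds @ [Suc (last ds)]"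
  let ?B = "if N < Suc m then {} else weighted_lists (Suc m) (N - Suc m)"
  have len: "\<exists>es d. ds = es @ [d] \<and> length es = m" if "length ds = Suc m" for ds :: "nat list"
    using that by (cases ds rule: rev_cases) auto
  have eq: "weighted_lists (Suc m) N = ?z ` weighted_lists m N \<union> ?s ` ?B"
  proof (intro equalityI subsetI)
    fix ds assume ds: "ds \<in> weighted_lists (Suc m) N"
    then obtain es d where es: "ds = es @ [d]" "length es = m"
      using len[of ds] by (auto simp: weighted_lists_def)
    show "ds \<in> ?z ` weighted_lists m N \<union> ?s ` ?B"
    proof (cases d)
      case 0
      thus ?thesis using ds es by (auto simp: weighted_lists_def weighted_sum_snoc)
    next
      case (Suc d')
      hence "es @ [d'] \<in> ?B" using ds es by (auto simp: weighted_lists_def weighted_sum_snoc)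
      moreover have "ds = ?s (es @ [d'])" using Suc es by simp
      ultimately show ?thesis by blast
    qed
  next
    fix ds assume "ds \<in> ?z ` weighted_lists m N \<union> ?s ` ?B"
    thus "ds \<in> weighted_lists (Suc m) N"
    proof
      assume "ds \<in> ?s ` ?B"
      then obtain xs where xs: "xs \<in> ?B" "ds = ?s xs" by blast
      then obtain es d where es: "xs = es @ [d]" "length es = m"
        using len[of xs] by (auto simp: weighted_lists_def split: if_splits)
      show ?thesis using xs es by (auto simp: weighted_lists_def weighted_sum_snoc split: if_splits)
    qed (auto simp: weighted_lists_def weighted_sum_snoc)
  qed
  have "inj_on ?s ?B"
  proof (rule inj_onI)
    fix xs ys assume "xs \<in> ?B" "ys \<in> ?B" and s: "?s xs = ?s ys"
    hence "xs \<noteq> []" "ys \<noteq> []" by (auto simp: weighted_lists_def split: if_splits)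
    thus "xs = ys" using s by (metis append1_eq_conv append_butlast_last_id nat.inject)
  qed
  hence "card (?s ` ?B) = card ?B" by (rule card_image)
  moreover have "card (?z ` weighted_lists m N) = card (weighted_lists m N)"
    by (rule card_image) (simp add: inj_on_def)
  moreover have "card (?z ` weighted_lists m N \<union> ?s ` ?B) = card (?z ` weighted_lists m N) + card (?s ` ?B)"
    by (rule card_Un_disjoint) auto
  ultimately show ?thesis by (simp add: eq)
qed

definition weighted_lists_fps :: "nat \<Rightarrow> rat fps" where
  "weighted_lists_fps m = Abs_fps (\<lambda>N. of_nat (card (weighted_lists m N)))"

lemma prod_mult_weighted_lists_fps: "(\<Prod>k=1..m. 1 - fps_X ^ k) * weighted_lists_fps m = 1"
proof (induction m)
  case 0
  have "weighted_lists 0 N = (if N = 0 then {[]} else {})" for N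
    by (auto simp: weighted_lists_def)
  hence "weighted_lists_fps 0 = 1"
    by (intro fps_ext) (simp add: weighted_lists_fps_def)
  thus ?case by simp
next
  case (Suc m)
  have "(1 - fps_X ^ Suc m) * weighted_lists_fps (Suc m) = weighted_lists_fps m"
  proof (rule fps_ext)
    fix N
    have "((1 - fps_X ^ Suc m) * weighted_lists_fps (Suc m)) $ N =
        weighted_lists_fps (Suc m) $ N - (fps_X ^ Suc m * weighted_lists_fps (Suc m)) $ N"
      by (simp only: left_diff_distrib mult_1 fps_sub_nth)
    also have "\<dots> = weighted_lists_fps m $ N"
      unfolding fps_X_power_mult_nth by (simp add: weighted_lists_fps_def card_weighted_lists_Suc[of m N])
    finally show "((1 - fps_X ^ Suc m) * weighted_lists_fps (Suc m)) $ N = weighted_lists_fps m $ N" .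
  qed
  thus ?case using Suc by (simp add: mult.assoc del: power_Suc)
qed

section \<open>From basis indices to partitions\<close>

primrec shifted_modes :: "nat \<Rightarrow> nat list \<Rightarrow> int list" where
  "shifted_modes i [] = []"
| "shifted_modes i (d # ds) = shifted_modes i ds @ [(if ds = [] then - 1 - int i else - 3) - int d]"

lemma length_shifted_modes [simp]: "length (shifted_modes i ds) = length ds"
  by (induction ds) auto

lemma shifted_modes_eq_Nil [simp]: "shifted_modes i ds = [] \<longleftrightarrow> ds = []"
  by (cases ds) auto

text \<open>Appending a mode leaves the earlier values of \<open>deg_D\<close> unchanged and adds
  one new value.\<close>

lemma deg_q_snoc: "deg_q (ls @ [l]) = deg_q ls - (sum_list ls + l + int (length ls))"
proof -
  have D: "deg_D (ls @ [l]) k = deg_D ls k" if "k \<in> {1..length ls}" for k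
    using that by (auto simp: deg_D_def nth_append intro!: sum.cong)
  have "(\<Sum>p=1..length ls. (ls @ [l]) ! (p - 1)) = (\<Sum>p=1..length ls. ls ! (p - 1))"
    by (intro sum.cong) (auto simp: nth_append)
  also have "\<dots> = sum_list ls"
    unfolding sum_list_sum_nth
    by (rule sum.reindex_bij_witness[of _ Suc "\<lambda>p. p - 1"]) auto
  finally have "deg_D (ls @ [l]) (Suc (length ls)) = sum_list ls + l + int (length ls)"
    by (simp add: deg_D_def)
  thus ?thesis using D by (simp add: deg_q_def)
qed

lemma sum_list_shifted_modes:
  "ds \<noteq> [] \<Longrightarrow> sum_list (shifted_modes i ds) = - int (sum_list ds) - 3 * int (length ds) + 2 - int i"
  by (induction ds) auto

text \<open>The largest admissible modes alone give \<open>m^2 + i m\<close>. Lowering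
  \<open>l_p\<close> by \<open>d\<close> lowers \<open>D_p, ..., D_m\<close>, so \<open>d\<close>
  counts \<open>m - p + 1\<close> times, which is its position in the list starting with the
  outermost mode.\<close>

lemma deg_q_shifted_modes:
  "deg_q (shifted_modes i ds) = int (length ds ^ 2 + i * length ds + weighted_sum ds)"
proof (induction ds)
  case Nil
  show ?case by (simp add: deg_q_def)
next
  case (Cons d ds)
  show ?case
  proof (cases "ds = []")
    case True
    thus ?thesis using deg_q_snoc[of "[]" "- 1 - int i - int d"] by (simp add: deg_q_def)
  next
    case False
    thus ?thesis using Cons
      by (simp add: deg_q_snoc sum_list_shifted_modes power2_eq_square algebra_simps)
  qed
qed

lemma basis_index_shifted_modes: "basis_index i (shifted_modes i ds)"
  by (induction ds) (auto simp: basis_index_snoc, simp add: basis_index_def)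

lemma basis_index_ex_shifted_modes: "basis_index i ls \<Longrightarrow> \<exists>ds. ls = shifted_modes i ds"
proof (induction ls rule: rev_induct)
  case Nil
  show ?case by (rule exI[of _ "[]"]) simp
next
  case (snoc l ls)
  then obtain ds where ds: "ls = shifted_modes i ds" by (auto simp: basis_index_snoc)
  define b where "b = (if ds = [] then - 1 - int i else - 3)"
  have "l \<le> b" using snoc.prems ds by (simp add: basis_index_snoc b_def)
  hence "ls @ [l] = shifted_modes i (nat (b - l) # ds)"
    by (simp add: ds b_def[symmetric])
  thus ?case by blast
qed

lemma inj_shifted_modes: "shifted_modes i ds = shifted_modes i ds' \<Longrightarrow> ds = ds'"
proof (induction ds arbitrary: ds')
  case Nil
  thus ?case by (metis shifted_modes_eq_Nil)
next
  case (Cons d ds)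
  then obtain d' rest where ds': "ds' = d' # rest"
    by (cases ds') auto
  with Cons show ?case by auto
qed

section \<open>Basis indices of a fixed degree\<close>

definition basis_indices :: "nat \<Rightarrow> nat \<Rightarrow> int list set" where
  "basis_indices i r = {ls. basis_index i ls \<and> deg_q ls = int r}"

lemma basis_indices_length:
  "{ls \<in> basis_indices i r. length ls = m} =
     (if r < m ^ 2 + i * m then {} else shifted_modes i ` weighted_lists m (r - (m ^ 2 + i * m)))"
  (is "?A = ?B")
proof (intro equalityI subsetI)
  fix ls assume "ls \<in> ?A"
  hence ls: "basis_index i ls" "deg_q ls = int r" "length ls = m" by (auto simp: basis_indices_def)
  obtain ds where ds: "ls = shifted_modes i ds" using basis_index_ex_shifted_modes[OF ls(1)] by blast
  have "length ds = m" using ls(3) ds by simp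
  moreover from this have "r = m ^ 2 + i * m + weighted_sum ds"
    using ls(2) deg_q_shifted_modes[of i ds] unfolding ds by (simp del: of_nat_add)
  ultimately show "ls \<in> ?B" using ds by (auto simp: weighted_lists_def)
next
  fix ls assume "ls \<in> ?B"
  then obtain ds where "r \<ge> m ^ 2 + i * m" "length ds = m" "weighted_sum ds = r - (m ^ 2 + i * m)"
    "ls = shifted_modes i ds"
    by (auto simp: weighted_lists_def split: if_splits)
  thus "ls \<in> ?A"
    by (simp add: basis_indices_def basis_index_shifted_modes deg_q_shifted_modes del: of_nat_add)
qed

lemma card_basis_indices_length:
  "card {ls \<in> basis_indices i r. length ls = m} =
     (if r < m ^ 2 + i * m then 0 else card (weighted_lists m (r - (m ^ 2 + i * m))))"
  unfolding basis_indices_length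
  by (simp add: card_image inj_on_def inj_shifted_modes[of i] cong: if_cong)

text \<open>Degree \<open>r\<close> forces \<open>m \<le> m^2 \<le> r\<close> for the length
  \<open>m\<close>, so lengths from \<open>k\<close> on do not occur.\<close>

lemma basis_indices_eq_UN:
  assumes "r < k"
  shows "basis_indices i r = (\<Union>m<k. {ls \<in> basis_indices i r. length ls = m})"
proof -
  have "length ls < k" if "ls \<in> basis_indices i r" for ls
  proof -
    have "ls \<in> {ls' \<in> basis_indices i r. length ls' = length ls}" using that by simp
    hence "length ls ^ 2 + i * length ls \<le> r"
      unfolding basis_indices_length by (auto split: if_splits)
    moreover have "length ls \<le> length ls ^ 2" by (cases "length ls") (simp_all add: power2_eq_square)
    ultimately show ?thesis using assms by linarith
  qed
  thus ?thesis by auto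
qed

lemma finite_basis_indices_length: "finite {ls \<in> basis_indices i r. length ls = m}"
  unfolding basis_indices_length by simp

lemma x_monomial_inj_on_basis:
  assumes "i = 0 \<or> i = 1"
  shows "inj_on (x_monomial i) (basis_indices i r)"
proof (rule inj_onI, rule ccontr)
  fix ls ls' assume *: "ls \<in> basis_indices i r" "ls' \<in> basis_indices i r"
    "x_monomial i ls = x_monomial i ls'" "ls \<noteq> ls'"
  let ?k = "\<lambda>x. if x = ls then 1 else - 1 :: F"
  have "(\<Sum>x\<in>{ls, ls'}. op_scale (?k x) (x_monomial i x)) = 0"
    using * by simp
  hence "?k ls = 0"
    by (rule x_monomial_independent[OF assms, rotated 2]) (use * in \<open>auto simp: basis_indices_def\<close>)
  thus False by simp
qed

text \<open>Independence is known for families indexed by mode lists; injectivity of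
  \<open>x_monomial\<close> on these transfers it to sets of vectors and equates the number of
  vectors with that of indices.\<close>

lemma dim_Wq_graded:
  assumes "i = 0 \<or> i = 1"
  shows "vector_space.dim op_scale (Wq_graded i r) = card (basis_indices i r)"
proof -
  let ?B = "x_monomial i ` basis_indices i r"
  have "op_space.independent ?B"
    unfolding op_space.independent_explicit_finite_subsets
  proof (intro allI impI ballI)
    fix S u v
    assume S: "S \<subseteq> ?B" "finite S" and zero: "(\<Sum>v\<in>S. op_scale (u v) v) = 0" and "v \<in> S"
    obtain L where L: "L \<subseteq> basis_indices i r" "S = x_monomial i ` L"
      using S(1) by (meson subset_image_iff)
    have inj: "inj_on (x_monomial i) L"
      using x_monomial_inj_on_basis[OF assms] L(1) by (rule inj_on_subset)
    have "finite L" using S(2) inj L(2) by (simp add: finite_image_iff)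
    obtain ls where ls: "ls \<in> L" "v = x_monomial i ls" using \<open>v \<in> S\<close> L(2) by blast
    have "(\<Sum>ls\<in>L. op_scale (u (x_monomial i ls)) (x_monomial i ls)) = 0"
      using zero unfolding L(2) sum.reindex[OF inj] by (simp add: o_def)
    thus "u v = 0" unfolding ls(2)
      by (rule x_monomial_independent[OF assms \<open>finite L\<close>, rotated 1])
         (use L(1) ls(1) in \<open>auto simp: basis_indices_def\<close>)
  qed
  hence "op_space.dim (op_space.span ?B) = card ?B"
    by (rule op_space.dim_span_eq_card_independent)
  moreover have "Wq_graded i r = op_space.span ?B"
    unfolding Wq_graded_def basis_indices_def by (rule arg_cong[of _ _ op_space.span]) auto
  ultimately show ?thesis
    using card_image[OF x_monomial_inj_on_basis[OF assms]] by simp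
qed

theorem theorem4p13:
  fixes i :: nat
  assumes "i = 0 \<or> i = 1"
  shows "(\<lambda>r::nat. fps_X ^ (r ^ 2 + i * r) / (\<Prod>k = 1..r. 1 - fps_X ^ k)) sums ch_Wq i"
  unfolding sums_def
proof (rule tendsto_fpsI)
  fix n
  let ?t = "\<lambda>r::nat. fps_X ^ (r ^ 2 + i * r) / (\<Prod>k = 1..r. 1 - fps_X ^ k) :: rat fps"
  have t: "?t m = fps_X ^ (m ^ 2 + i * m) * weighted_lists_fps m" for m
  proof -
    let ?P = "\<Prod>k = 1..m. 1 - fps_X ^ k :: rat fps"
    \<comment> \<open>The product of \<open>?P\<close> with \<open>weighted_lists_fps m\<close> is
      1, so the quotient of series is multiplication by an inverse.\<close>
    have unit: "?P $ 0 \<noteq> 0"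
      using prod_mult_weighted_lists_fps[of m] by (metis fps_mult_nth_0 fps_one_nth mult_zero_left zero_neq_one)
    have "inverse ?P = weighted_lists_fps m"
      using prod_mult_weighted_lists_fps[of m] by (rule fps_inverse_unique)
    thus ?thesis using fps_divide_unit[OF unit] by simp
  qed
  \<comment> \<open>The summand for \<open>m\<close> counts the basis elements with \<open>m\<close>
    factors \<open>x(z)\<close>: the numerator stands for the largest modes, the denominator for the
    partitions.\<close>
  have tn: "?t m $ n = of_nat (card {ls \<in> basis_indices i n. length ls = m})" for m
    unfolding t fps_X_power_mult_nth card_basis_indices_length by (simp add: weighted_lists_fps_def)
  \<comment> \<open>Lengths above \<open>n\<close> contribute nothing in degree \<open>n\<close>, so
    coefficient \<open>n\<close> of the partial sums is constant for \<open>k > n\<close>; this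
    stabilisation is convergence of formal power series.\<close>
  have "(\<Sum>m<k. ?t m) $ n = ch_Wq i $ n" if "k > n" for k
  proof -
    have "(\<Sum>m<k. ?t m) $ n = of_nat (\<Sum>m<k. card {ls \<in> basis_indices i n. length ls = m})"
      by (simp only: fps_sum_nth tn of_nat_sum)
    also have "(\<Sum>m<k. card {ls \<in> basis_indices i n. length ls = m}) =
        card (\<Union>m<k. {ls \<in> basis_indices i n. length ls = m})"
      by (rule card_UN_disjoint[symmetric]) (simp_all add: finite_basis_indices_length, blast)
    finally show ?thesis
      using basis_indices_eq_UN[OF that, of i] by (simp add: ch_Wq_def dim_Wq_graded[OF assms])
  qed
  thus "\<forall>\<^sub>F k in sequentially. (\<Sum>m<k. ?t m) $ n = ch_Wq i $ n"
    unfolding eventually_sequentially by (intro exI[of _ "Suc n"]) auto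
qed

end
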